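(* Let $0<\epsilon<1$, and let $\omega\geq 2$ and $D\geq 3$ be integers. Let $\Gamma$ be a $2$-walk-regular graph with valency $k$, diameter $D$, smallest eigenvalue at least $-\omega$, and with $c_2\geq a_1\epsilon$. Then $k<D^2\left(\frac{2\omega^2}{\epsilon}\right)^{2D+4}$. In particular, up to isomorphism there are only finitely many such graphs.
   Context: All graphs are finite, simple and connected. A graph is $2$-walk-regular if it has diameter at least $2$ and for every $\ell\geq0$ the number of walks of length $\ell$ between $x$ and $y$ depends only on $\mathrm{dist}(x,y)$ whenever $\mathrm{dist}(x,y)\leq 2$. Such a graph is regular with valency $k$, and the following are constants: $a_1$, the number of common neighbors of two adjacent vertices, and $c_2$, the number of common neighbors of two vertices at distance $2$. Eigenvalues are those of the adjacency matrix. *)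

theory Defs
  imports
    Complex_Main
    "Graph_Theory.Graph_Theory"
    "Jordan_Normal_Form.Spectral_Radius"
begin

text \<open>
  A finite simple graph is a \<open>pair_graph\<close>: a finite, loop-free, symmetric set of
  ordered pairs of vertices. The edge \<open>{x, y}\<close> is represented by the two arcs \<open>(x, y)\<close>
  and \<open>(y, x)\<close>, so that directed walks are exactly the walks of the undirected graph.
\<close>

definition num_walks :: "'a pair_pre_digraph \<Rightarrow> nat \<Rightarrow> 'a \<Rightarrow> 'a \<Rightarrow> nat" where
  "num_walks G l x y = card {p. pre_digraph.awalk (with_proj G) x p y \<and> length p = l}"

text \<open>Only meaningful for vertices joined by a walk, hence always used for connected graphs.\<close>

definition graph_dist :: "'a pair_pre_digraph \<Rightarrow> 'a \<Rightarrow> 'a \<Rightarrow> nat" where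
  "graph_dist G x y = (LEAST l. \<exists>p. pre_digraph.awalk (with_proj G) x p y \<and> length p = l)"

definition diameter :: "'a pair_pre_digraph \<Rightarrow> nat" where
  "diameter G = Max {graph_dist G x y | x y. x \<in> pverts G \<and> y \<in> pverts G}"

definition two_walk_regular :: "'a pair_pre_digraph \<Rightarrow> bool" where
  "two_walk_regular G \<longleftrightarrow>
     pair_graph G \<and> Digraph_Component.connected (with_proj G) \<and> 2 \<le> diameter G \<and>
     (\<forall>l. \<forall>x\<in>pverts G. \<forall>y\<in>pverts G. \<forall>x'\<in>pverts G. \<forall>y'\<in>pverts G.
        graph_dist G x y \<le> 2 \<and> graph_dist G x' y' = graph_dist G x y \<longrightarrow>
        num_walks G l x' y' = num_walks G l x y)"

definition common_neighbors :: "'a pair_pre_digraph \<Rightarrow> 'a \<Rightarrow> 'a \<Rightarrow> 'a set" where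
  "common_neighbors G x y = {z \<in> pverts G. (x, z) \<in> parcs G \<and> (y, z) \<in> parcs G}"

text \<open>
  The three constants below are well defined for 2-walk-regular graphs; see the lemmas
  \<open>ex1_valency\<close>, \<open>ex1_a1\<close> and \<open>ex1_c2\<close> at the end of this theory.
\<close>

definition valency :: "'a pair_pre_digraph \<Rightarrow> nat" where
  "valency G = (THE k. \<forall>x\<in>pverts G. out_degree (with_proj G) x = k)"

definition a1 :: "'a pair_pre_digraph \<Rightarrow> nat" where
  "a1 G = (THE a. \<forall>x\<in>pverts G. \<forall>y\<in>pverts G. (x, y) \<in> parcs G \<longrightarrow>
                    card (common_neighbors G x y) = a)"

definition c2 :: "'a pair_pre_digraph \<Rightarrow> nat" where
  "c2 G = (THE c. \<forall>x\<in>pverts G. \<forall>y\<in>pverts G. graph_dist G x y = 2 \<longrightarrow>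
                    card (common_neighbors G x y) = c)"

text \<open>
  Matrices are indexed by natural numbers, so an enumeration of the vertices is fixed.
  Another enumeration conjugates the matrix by a permutation matrix, which does not
  affect its eigenvalues.
\<close>

definition vertex_list :: "'a pair_pre_digraph \<Rightarrow> 'a list" where
  "vertex_list G = (SOME vs. set vs = pverts G \<and> distinct vs)"

definition adjacency_matrix :: "'a pair_pre_digraph \<Rightarrow> real mat" where
  "adjacency_matrix G =
     (let vs = vertex_list G; n = length vs
      in mat n n (\<lambda>(i, j). if (vs ! i, vs ! j) \<in> parcs G then 1 else 0))"

definition smallest_eigenvalue :: "'a pair_pre_digraph \<Rightarrow> real" where
  "smallest_eigenvalue G = Min (spectrum (adjacency_matrix G))"

lemma num_walks_2:
  assumes "pair_graph G" "x \<in> pverts G" "y \<in> pverts G"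
  shows "num_walks G 2 x y = card (common_neighbors G x y)"
proof -
  interpret pair_graph G by fact
  have "bij_betw (\<lambda>z. [(x, z), (z, y)]) (common_neighbors G x y)
          {p. pre_digraph.awalk (with_proj G) x p y \<and> length p = 2}"
  proof (rule bij_betw_imageI)
    show "inj_on (\<lambda>z. [(x, z), (z, y)]) (common_neighbors G x y)"
      by (auto simp: inj_on_def)
    show "(\<lambda>z. [(x, z), (z, y)]) ` common_neighbors G x y =
          {p. pre_digraph.awalk (with_proj G) x p y \<and> length p = 2}"
    proof (intro equalityI subsetI)
      fix p assume "p \<in> (\<lambda>z. [(x, z), (z, y)]) ` common_neighbors G x y"
      then show "p \<in> {p. pre_digraph.awalk (with_proj G) x p y \<and> length p = 2}"
        using assms by (auto simp: common_neighbors_def awalk_def intro: arcs_symmetric)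
    next
      fix p assume "p \<in> {p. pre_digraph.awalk (with_proj G) x p y \<and> length p = 2}"
      then obtain e f where "p = [e, f]" and w: "awalk x [e, f] y"
        by (auto simp: length_Suc_conv numeral_2_eq_2)
      then show "p \<in> (\<lambda>z. [(x, z), (z, y)]) ` common_neighbors G x y"
        by (cases e; cases f)
           (auto simp: common_neighbors_def awalk_def intro: arcs_symmetric dest: in_arcsD1)
    qed
  qed
  then show ?thesis
    by (simp add: num_walks_def bij_betw_same_card)
qed

lemma graph_dist_self: "x \<in> pverts G \<Longrightarrow> graph_dist G x x = 0"
  unfolding graph_dist_def
  by (rule Least_eq_0) (auto simp: pre_digraph.awalk_def pre_digraph.cas.simps)

lemma graph_dist_arc:
  assumes "pair_graph G" "(x, y) \<in> parcs G"
  shows "graph_dist G x y = 1"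
proof -
  interpret pair_graph G by fact
  have "x \<noteq> y" using assms(2) no_loops by force
  show ?thesis
    unfolding graph_dist_def
  proof (rule Least_equality)
    show "\<exists>p. awalk x p y \<and> length p = 1"
      using assms(2) by (intro exI[of _ "[(x, y)]"]) (auto simp: awalk_def dest: in_arcsD1)
    show "1 \<le> l" if "\<exists>p. awalk x p y \<and> length p = l" for l
      using that \<open>x \<noteq> y\<close> by (cases l) (auto simp: awalk_def)
  qed
qed

lemma out_degree_eq_num_walks:
  assumes "pair_graph G" "x \<in> pverts G"
  shows "out_degree (with_proj G) x = num_walks G 2 x x"
proof -
  interpret pair_graph G by fact
  have "out_arcs (with_proj G) x = Pair x ` common_neighbors G x x"
    by (auto simp: out_arcs_def common_neighbors_def dest: in_arcsD2)
  then show ?thesis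
    using assms by (simp add: out_degree_def num_walks_2 card_image inj_on_def)
qed

lemma reachable_dist:
  assumes "pair_graph G" "Digraph_Component.connected (with_proj G)"
    "x \<in> pverts G" "y \<in> pverts G"
  shows "\<exists>p. pre_digraph.awalk (with_proj G) x p y \<and> length p = graph_dist G x y"
proof -
  interpret pair_graph G by fact
  have "mk_symmetric (with_proj G) = G"
    using arcs_symmetric by (intro pair_pre_digraph.equality) (fastforce simp: mk_symmetric_def)+
  then have "x \<rightarrow>\<^sup>*\<^bsub>with_proj G\<^esub> y"
    using assms by (simp add: connected_def strongly_connected_def)
  then have "\<exists>l p. awalk x p y \<and> length p = l"
    by (simp add: reachable_awalk)
  then show ?thesis
    unfolding graph_dist_def by (rule LeastI_ex)
qed

lemma ex_dist_2:
  assumes "two_walk_regular G"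
  shows "\<exists>x\<in>pverts G. \<exists>y\<in>pverts G. graph_dist G x y = 2"
proof -
  have G: "pair_graph G" "Digraph_Component.connected (with_proj G)" "2 \<le> diameter G"
    using assms by (auto simp: two_walk_regular_def)
  interpret pair_graph G by (rule G(1))
  let ?S = "{graph_dist G x y | x y. x \<in> pverts G \<and> y \<in> pverts G}"
  have fin: "finite ?S"
    by (rule finite_subset[of _ "(\<lambda>(x, y). graph_dist G x y) ` (pverts G \<times> pverts G)"])
       (use pair_finite_verts in auto)
  have "pverts G \<noteq> {}"
    using G(2) by (simp add: connected_def strongly_connected_def mk_symmetric_def)
  then have "?S \<noteq> {}" by blast
  then have "diameter G \<in> ?S"
    unfolding diameter_def using Max_in fin by blast
  then obtain x y where xy: "x \<in> pverts G" "y \<in> pverts G" "2 \<le> graph_dist G x y"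
    using G(3) by auto
  obtain p where p: "awalk x p y" "length p = graph_dist G x y"
    using reachable_dist[OF G(1,2) xy(1,2)] by auto
  define z where "z = last (pawalk_verts x (take 2 p))"
  have "awalk x (take 2 p @ drop 2 p) y" using p by simp
  then have w: "awalk x (take 2 p) z" "awalk z (drop 2 p) y"
    unfolding z_def awalk_append_iff by blast+
  have z: "z \<in> pverts G" using w(2) by (auto simp: awalk_def)
  obtain q where q: "awalk x q z" "length q = graph_dist G x z"
    using reachable_dist[OF G(1,2) xy(1) z] by auto
  have "graph_dist G x z \<le> 2"
    unfolding graph_dist_def using w(1) p(2) xy(3) by (intro Least_le exI[of _ "take 2 p"]) auto
  moreover have "awalk x (q @ drop 2 p) y"
    using q(1) w(2) by (rule awalk_appendI)
  then have "graph_dist G x y \<le> length (q @ drop 2 p)"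
    unfolding graph_dist_def by (intro Least_le) blast
  then have "2 \<le> graph_dist G x z"
    using p(2) q(2) xy(3) by simp
  ultimately show ?thesis using xy(1) z by (intro bexI[of _ x] bexI[of _ z]) auto
qed

lemma ex_arc:
  assumes "two_walk_regular G"
  shows "\<exists>x y. (x, y) \<in> parcs G"
proof -
  have G: "pair_graph G" "Digraph_Component.connected (with_proj G)"
    using assms by (auto simp: two_walk_regular_def)
  obtain x y where "x \<in> pverts G" "y \<in> pverts G" "graph_dist G x y = 2"
    using ex_dist_2[OF assms] by blast
  then obtain p where "pre_digraph.awalk (with_proj G) x p y" "length p = 2"
    using reachable_dist[OF G] by metis
  then show ?thesis
    by (cases p) (auto simp: pre_digraph.awalk_def)
qed

lemma ex1_valency:
  assumes "two_walk_regular G"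
  shows "\<exists>!k. \<forall>x\<in>pverts G. out_degree (with_proj G) x = k"
proof -
  have G: "pair_graph G" using assms by (auto simp: two_walk_regular_def)
  obtain x where x: "x \<in> pverts G" using ex_dist_2[OF assms] by blast
  have "out_degree (with_proj G) y = out_degree (with_proj G) x" if "y \<in> pverts G" for y
  proof -
    have "num_walks G 2 y y = num_walks G 2 x x"
      using assms x that graph_dist_self[OF x] graph_dist_self[OF that]
      unfolding two_walk_regular_def by (metis zero_le)
    then show ?thesis using G x that by (simp add: out_degree_eq_num_walks)
  qed
  then show ?thesis using x by metis
qed

lemma ex1_a1:
  assumes "two_walk_regular G"
  shows "\<exists>!a. \<forall>x\<in>pverts G. \<forall>y\<in>pverts G. (x, y) \<in> parcs G \<longrightarrow>
                card (common_neighbors G x y) = a"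
proof -
  have G: "pair_graph G" using assms by (auto simp: two_walk_regular_def)
  interpret pair_graph G by (rule G)
  obtain x y where xy: "(x, y) \<in> parcs G" using ex_arc[OF assms] by blast
  then have v: "x \<in> pverts G" "y \<in> pverts G" by (auto dest: in_arcsD1 in_arcsD2)
  have "card (common_neighbors G x' y') = card (common_neighbors G x y)"
    if "x' \<in> pverts G" "y' \<in> pverts G" "(x', y') \<in> parcs G" for x' y'
  proof -
    have "num_walks G 2 x' y' = num_walks G 2 x y"
      using assms v that graph_dist_arc[OF G xy] graph_dist_arc[OF G that(3)]
      unfolding two_walk_regular_def by (metis one_le_numeral)
    then show ?thesis using G v that by (simp add: num_walks_2)
  qed
  then show ?thesis using xy v by metis
qed

lemma ex1_c2:
  assumes "two_walk_regular G"
  shows "\<exists>!c. \<forall>x\<in>pverts G. \<forall>y\<in>pverts G. graph_dist G x y = 2 \<longrightarrow>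
                card (common_neighbors G x y) = c"
proof -
  have G: "pair_graph G" using assms by (auto simp: two_walk_regular_def)
  obtain x y where xy: "x \<in> pverts G" "y \<in> pverts G" "graph_dist G x y = 2"
    using ex_dist_2[OF assms] by blast
  have "card (common_neighbors G x' y') = card (common_neighbors G x y)"
    if "x' \<in> pverts G" "y' \<in> pverts G" "graph_dist G x' y' = 2" for x' y'
  proof -
    have "num_walks G 2 x' y' = num_walks G 2 x y"
      using assms xy that unfolding two_walk_regular_def by (metis order_refl)
    then show ?thesis using G xy that by (simp add: num_walks_2)
  qed
  then show ?thesis using xy by metis
qed

end

theory Submission
  imports "HOL-Analysis.Elementary_Metric_Spaces" Defs
begin

text \<open>
  Write \<open>k\<close> for the valency, \<open>n\<close> for the order and \<open>R = 2 \<omega>\<^sup>2 / \<epsilon>\<close>. A star with more than \<open>\<omega>\<^sup>2\<close> leaves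
  has an eigenvalue below \<open>-\<omega>\<close>, so a maximal independent set among the neighbours of a vertex
  gives \<open>k \<le> \<omega>\<^sup>2 (a\<^sub>1 + 1)\<close>, whence \<open>k / c\<^sub>2 \<le> R\<close>. Consecutive distance layers grow at most by
  the factor \<open>k / c\<^sub>2\<close>, so \<open>n \<le> k D R\<^bsup>D-1\<^esup>\<close> is linear in \<open>k\<close>.

  Let \<open>\<theta>\<close> be the second largest eigenvalue. Summing \<open>(\<lambda> + \<omega>) (\<theta> - \<lambda>) \<ge> 0\<close> over all eigenvalues but
  \<open>k\<close>, with \<open>n \<ge> 2k + 2\<close> from \<open>D \<ge> 3\<close>, gives \<open>2 \<omega> \<theta> \<ge> k - \<omega>\<close>; the trace of the squared adjacency
  matrix then bounds the multiplicity \<open>m\<close> of \<open>\<theta>\<close> by a multiple of \<open>n / k\<close>. Finally, by 2-walk-regularity the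
  projections of the neighbours of a vertex onto the eigenspace of \<open>\<theta>\<close> form a spherical
  two-distance set, so \<open>k \<le> (m + 1)\<^sup>2\<close>.
\<close>

section \<open>Spectral decomposition of symmetric matrices\<close>

locale symmetric_matrix =
  fixes V :: "'a set" and A :: "'a \<Rightarrow> 'a \<Rightarrow> real"
  assumes fin: "finite V"
    and sym: "x \<in> V \<Longrightarrow> y \<in> V \<Longrightarrow> A x y = A y x"
begin

definition dot :: "('a \<Rightarrow> real) \<Rightarrow> ('a \<Rightarrow> real) \<Rightarrow> real" where
  "dot f g = (\<Sum>x\<in>V. f x * g x)"

definition app :: "('a \<Rightarrow> real) \<Rightarrow> 'a \<Rightarrow> real" where
  "app f = (\<lambda>x. \<Sum>y\<in>V. A x y * f y)"

lemma dot_commute: "dot f g = dot g f"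
  by (simp add: dot_def mult.commute)

lemma dot_cong: "(\<And>x. x \<in> V \<Longrightarrow> f x = f' x) \<Longrightarrow> (\<And>x. x \<in> V \<Longrightarrow> g x = g' x) \<Longrightarrow> dot f g = dot f' g'"
  by (simp add: dot_def)

lemma dot_lin: "dot f (\<lambda>x. a * g x + b * h x) = a * dot f g + b * dot f h"
  by (simp add: dot_def sum.distrib sum_distrib_left algebra_simps)

lemma app_lin: "app (\<lambda>x. a * g x + b * h x) = (\<lambda>x. a * app g x + b * app h x)"
  by (simp add: app_def sum.distrib sum_distrib_left algebra_simps)

lemma dot_sum: "dot f (\<lambda>x. \<Sum>i\<in>I. c i * g i x) = (\<Sum>i\<in>I. c i * dot f (g i))"
proof -
  have "dot f (\<lambda>x. \<Sum>i\<in>I. c i * g i x) = (\<Sum>x\<in>V. \<Sum>i\<in>I. c i * (f x * g i x))"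
    by (simp add: dot_def sum_distrib_left algebra_simps)
  also have "\<dots> = (\<Sum>i\<in>I. \<Sum>x\<in>V. c i * (f x * g i x))" by (rule sum.swap)
  finally show ?thesis by (simp add: dot_def sum_distrib_left)
qed

lemma dot_self_nonneg: "0 \<le> dot f f"
  by (simp add: dot_def sum_nonneg)

lemma dot_self_eq_0: "dot f f = 0 \<longleftrightarrow> (\<forall>x\<in>V. f x = 0)"
  using fin by (simp add: dot_def sum_nonneg_eq_0_iff)

lemma app_symmetric: "dot f (app g) = dot g (app f)"
proof -
  have "dot f (app g) = (\<Sum>x\<in>V. \<Sum>y\<in>V. A x y * f x * g y)"
    by (simp add: dot_def app_def sum_distrib_left algebra_simps)
  also have "\<dots> = (\<Sum>y\<in>V. \<Sum>x\<in>V. A x y * f x * g y)" by (rule sum.swap)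
  also have "\<dots> = (\<Sum>y\<in>V. \<Sum>x\<in>V. A y x * f x * g y)"
    by (intro sum.cong refl) (metis sym)
  also have "\<dots> = dot g (app f)"
    by (simp add: dot_def app_def sum_distrib_left algebra_simps)
  finally show ?thesis .
qed

text \<open>Compactness of the unit sphere in the orthogonal complement of \<open>U\<close>.
  Functions are unconstrained outside \<open>V\<close>, so compactness is used in the form of
  pointwise convergence on the finite set \<open>V\<close>; \<open>f0\<close> shows that the sphere
  is nonempty.\<close>

lemma rayleigh_maximizer:
  assumes f0: "\<forall>u\<in>U. dot u f0 = 0" "dot f0 f0 \<noteq> 0"
  obtains g where "\<forall>u\<in>U. dot u g = 0" "dot g g = 1"
    "\<And>f. \<forall>u\<in>U. dot u f = 0 \<Longrightarrow> dot f (app f) \<le> dot g (app g) * dot f f"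
proof -
  define S where "S = {f. (\<forall>u\<in>U. dot u f = 0) \<and> dot f f = 1}"
  define Q where "Q = (\<lambda>f. dot f (app f))"
  have scale: "dot u (\<lambda>x. c * f x) = c * dot u f" "dot (\<lambda>x. c * f x) u = c * dot f u"
    "app (\<lambda>x. c * f x) = (\<lambda>x. c * app f x)" for u c f
    by (auto simp: dot_def app_def sum_distrib_left algebra_simps)
  have normal: "(\<lambda>x. 1 / sqrt (dot f f) * f x) \<in> S"
    if "\<forall>u\<in>U. dot u f = 0" "dot f f \<noteq> 0" for f
    using that dot_self_nonneg[of f] unfolding S_def mem_Collect_eq scale by simp
  have bd: "\<bar>f x\<bar> \<le> 1" if "f \<in> S" "x \<in> V" for f x
  proof -
    have "f x * f x \<le> dot f f"
      unfolding dot_def using fin that(2) by (intro member_le_sum) auto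
    then show ?thesis using that(1) abs_le_square_iff[of "f x" 1] by (simp add: S_def power2_eq_square)
  qed
  \<comment> \<open>Entries of a unit vector are at most 1 in absolute value, which bounds the
    quadratic form on the sphere and makes the supremum \<open>s\<close> meaningful.\<close>
  have Qbd: "Q f \<le> (\<Sum>x\<in>V. \<Sum>y\<in>V. \<bar>A x y\<bar>)" if "f \<in> S" for f
  proof -
    have "f x * (A x y * f y) \<le> \<bar>A x y\<bar>" if "x \<in> V" "y \<in> V" for x y
    proof -
      have "\<bar>f x\<bar> * (\<bar>A x y\<bar> * \<bar>f y\<bar>) \<le> 1 * (\<bar>A x y\<bar> * 1)"
        using bd \<open>f \<in> S\<close> that by (intro mult_mono) auto
      then show ?thesis by (metis abs_ge_self abs_mult mult_1 mult.right_neutral order_trans)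
    qed
    then show ?thesis by (auto simp: Q_def dot_def app_def sum_distrib_left intro!: sum_mono)
  qed
  define s where "s = Sup (Q ` S)"
  have ne: "Q ` S \<noteq> {}" using normal[OF f0] by blast
  have bdd: "bdd_above (Q ` S)" using Qbd by (intro bdd_aboveI2)
  have "\<exists>f. f \<in> S \<and> s - 1 / real (Suc n) < Q f" for n
    using less_cSup_iff[OF ne bdd, of "s - 1 / real (Suc n)"] by (auto simp: s_def)
  then obtain F where F: "F n \<in> S" "s - 1 / real (Suc n) < Q (F n)" for n by metis
  \<comment> \<open>Bolzano-Weierstrass for the maximizing sequence \<open>F\<close>, in the
    finitely many coordinates from \<open>V\<close>.\<close>
  have "\<exists>l::'a\<Rightarrow>real. \<exists>r::nat\<Rightarrow>nat. strict_mono r \<and>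
      (\<forall>e>0. eventually (\<lambda>n. \<forall>i\<in>V. dist (F (r n) i) (l i) < e) sequentially)"
    by (rule compact_lemma_general[where proj="\<lambda>f x. f x" and unproj="\<lambda>f. f" and basis=V, rule_format])
       (use fin bd F(1) in \<open>auto simp: bounded_iff\<close>)
  then obtain l :: "'a \<Rightarrow> real" and r :: "nat \<Rightarrow> nat" where r: "strict_mono r"
    and l: "\<And>e. e > 0 \<Longrightarrow> eventually (\<lambda>n. \<forall>i\<in>V. dist (F (r n) i) (l i) < e) sequentially" by blast
  have lim: "(\<lambda>n. F (r n) x) \<longlonglongrightarrow> l x" if "x \<in> V" for x
    unfolding tendsto_iff using l that by (fastforce elim: eventually_mono)
  have "dot u l = 0" if "u \<in> U" for u
  proof (rule LIMSEQ_unique)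
    show "(\<lambda>n. dot u (F (r n))) \<longlonglongrightarrow> dot u l"
      unfolding dot_def by (intro tendsto_intros lim)
    show "(\<lambda>n. dot u (F (r n))) \<longlonglongrightarrow> 0" using F(1) that by (simp add: S_def)
  qed
  moreover have l1: "dot l l = 1"
  proof (rule LIMSEQ_unique)
    show "(\<lambda>n. dot (F (r n)) (F (r n))) \<longlonglongrightarrow> dot l l"
      unfolding dot_def by (intro tendsto_intros lim)
    show "(\<lambda>n. dot (F (r n)) (F (r n))) \<longlonglongrightarrow> 1" using F(1) by (simp add: S_def)
  qed
  ultimately have "l \<in> S" by (simp add: S_def)
  have Ql: "(\<lambda>n. Q (F (r n))) \<longlonglongrightarrow> Q l"
    unfolding Q_def dot_def app_def by (intro tendsto_intros lim)
  have "s \<le> Q l"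
  proof (rule LIMSEQ_le[OF _ Ql])
    have "(\<lambda>n. s - 1 / real (Suc n)) \<longlonglongrightarrow> s - 0"
      by (intro tendsto_intros LIMSEQ_Suc lim_1_over_n)
    then show "(\<lambda>n. s - 1 / real (Suc (r n))) \<longlonglongrightarrow> s"
      using LIMSEQ_subseq_LIMSEQ[OF _ r, of "\<lambda>n. s - 1 / real (Suc n)" s] by (simp add: o_def)
    show "\<exists>N. \<forall>n\<ge>N. s - 1 / real (Suc (r n)) \<le> Q (F (r n))"
      using F(2) less_imp_le by blast
  qed
  have "Q f \<le> Q l * dot f f" if "\<forall>u\<in>U. dot u f = 0" for f
  proof (cases "dot f f = 0")
    case True
    then have "Q f = 0" using dot_self_eq_0 by (simp add: Q_def dot_def)
    then show ?thesis using True by simp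
  next
    case False
    define g where "g = (\<lambda>x. 1 / sqrt (dot f f) * f x)"
    have "Q g \<le> s" unfolding s_def g_def using normal[OF that False] bdd by (intro cSup_upper) auto
    then have "Q g \<le> Q l" using \<open>s \<le> Q l\<close> by simp
    moreover have "Q g = Q f / dot f f"
      proof -
      have "Q g = 1 / sqrt (dot f f) * (1 / sqrt (dot f f)) * Q f"
        unfolding Q_def g_def scale by (simp only: mult.assoc)
      then show ?thesis using dot_self_nonneg[of f] by simp
    qed
    ultimately show ?thesis using False dot_self_nonneg[of f] by (simp add: field_simps)
  qed
  then show ?thesis using that \<open>l \<in> S\<close> by (auto simp: S_def Q_def)
qed

definition eigensystem :: "nat \<Rightarrow> (nat \<Rightarrow> 'a \<Rightarrow> real) \<Rightarrow> (nat \<Rightarrow> real) \<Rightarrow> bool" where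
  "eigensystem r u l \<longleftrightarrow>
     (\<forall>i<r. \<forall>j<r. dot (u i) (u j) = (if i = j then 1 else 0)) \<and>
     (\<forall>i<r. \<forall>x\<in>V. app (u i) x = l i * u i x)"

text \<open>Variational proof of the spectral theorem: the maximizer \<open>g\<close> of the
  Rayleigh quotient on the complement of the known eigenvectors is again an eigenvector. Symmetry
  makes \<open>app g\<close> orthogonal to them too, so the defect \<open>h\<close> of the
  eigenvalue equation is an admissible direction of variation, and maximality forces it to
  vanish.\<close>

lemma eigensystem_extend:
  assumes E: "eigensystem r u l"
    and f0: "\<forall>i<r. dot (u i) f0 = 0" "dot f0 f0 \<noteq> 0"
  obtains g \<theta> where "eigensystem (Suc r) (u(r := g)) (l(r := \<theta>))"
proof -
  obtain g where g: "\<forall>h\<in>u ` {..<r}. dot h g = 0" "dot g g = 1"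
    "\<And>f. \<forall>h\<in>u ` {..<r}. dot h f = 0 \<Longrightarrow> dot f (app f) \<le> dot g (app g) * dot f f"
    using rayleigh_maximizer[of "u ` {..<r}" f0] f0 by blast
  define \<theta> where "\<theta> = dot g (app g)"
  define h where "h = (\<lambda>x. 1 * app g x + (-\<theta>) * g x)"
  have inv: "dot (u i) (app g) = 0" if "i < r" for i
  proof -
    have "dot (u i) (app g) = dot g (app (u i))" by (rule app_symmetric)
    also have "\<dots> = dot g (\<lambda>x. l i * u i x + 0 * g x)"
      using E that by (intro dot_cong) (auto simp: eigensystem_def)
    also have "\<dots> = 0" unfolding dot_lin using g(1) that by (auto simp: dot_commute)
    finally show ?thesis .
  qed
  have orth: "dot (u i) h = 0" if "i < r" for i
    unfolding h_def dot_lin using inv g(1) that by auto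
  have hh: "dot h h = dot h (app g) - \<theta> * dot h g"
    using dot_lin[of h 1 "app g" "-\<theta>" g] unfolding h_def[symmetric] by simp
  \<comment> \<open>First variation of the Rayleigh quotient at \<open>g\<close> in the direction \<open>h\<close>.\<close>
  have key: "2 * t * dot h h \<le> t\<^sup>2 * (\<theta> * dot h h - dot h (app h))" for t
  proof -
    let ?f = "\<lambda>x. 1 * g x + t * h x"
    have "dot ?f (app ?f) \<le> \<theta> * dot ?f ?f"
      unfolding \<theta>_def by (rule g(3)) (use g(1) orth in \<open>auto simp only: dot_lin; auto\<close>)
    moreover have "dot ?f (app ?f) = \<theta> + 2 * t * dot h (app g) + t\<^sup>2 * dot h (app h)"
    proof -
      have "dot ?f (app ?f) = dot ?f (app g) + t * dot ?f (app h)"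
        unfolding app_lin by (subst dot_lin) simp
      also have "dot ?f (app g) = \<theta> + t * dot h (app g)"
        using dot_lin[of "app g" 1 g t h] by (simp add: dot_commute \<theta>_def)
      also have "dot ?f (app h) = dot h (app g) + t * dot h (app h)"
        using dot_lin[of "app h" 1 g t h] app_symmetric[of g h] by (simp add: dot_commute)
      finally show ?thesis by (simp add: algebra_simps power2_eq_square)
    qed
    moreover have "dot ?f ?f = 1 + 2 * t * dot h g + t\<^sup>2 * dot h h"
    proof -
      have "dot ?f ?f = dot ?f g + t * dot ?f h" by (subst dot_lin) simp
      also have "dot ?f g = 1 + t * dot h g"
        using dot_lin[of g 1 g t h] g(2) by (simp add: dot_commute)
      also have "dot ?f h = dot h g + t * dot h h"
        using dot_lin[of h 1 g t h] by (simp add: dot_commute)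
      finally show ?thesis by (simp add: algebra_simps power2_eq_square)
    qed
    ultimately have "\<theta> + 2 * t * dot h (app g) + t\<^sup>2 * dot h (app h) \<le>
        \<theta> * (1 + 2 * t * dot h g + t\<^sup>2 * dot h h)" by metis
    moreover have "2 * t * dot h h = 2 * t * dot h (app g) - 2 * t * (\<theta> * dot h g)"
      unfolding hh by (simp only: right_diff_distrib)
    ultimately show ?thesis by (simp add: algebra_simps)
  qed
  have "dot h h = 0"
  proof (rule ccontr)
    assume "dot h h \<noteq> 0"
    then have p: "dot h h > 0" using dot_self_nonneg[of h] by simp
    \<comment> \<open>The left side of \<open>key\<close> is linear in \<open>t\<close> and the
      right side quadratic, so a small positive \<open>t\<close> gives a contradiction. The added 1
      keeps the divisor \<open>K\<close> positive.\<close>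
    define K where "K = \<bar>\<theta> * dot h h - dot h (app h)\<bar> + 1"
    have K: "K > 0" "\<theta> * dot h h - dot h (app h) \<le> K" by (auto simp: K_def)
    define t where "t = dot h h / K"
    have t: "t > 0" using p K by (simp add: t_def)
    have "2 * t * dot h h \<le> t\<^sup>2 * K"
      using key[of t] mult_left_mono[OF K(2), of "t\<^sup>2"] by simp
    also have "t\<^sup>2 * K = t * dot h h" using K by (simp add: t_def power2_eq_square)
    finally show False using t p by simp
  qed
  then have "\<forall>x\<in>V. app g x = \<theta> * g x" by (auto simp: dot_self_eq_0 h_def)
  then have "eigensystem (Suc r) (u(r := g)) (l(r := \<theta>))"
    using E g(1,2) by (auto simp: eigensystem_def less_Suc_eq dot_commute)
  then show ?thesis using that by blast
qed

definition delta :: "'a \<Rightarrow> 'a \<Rightarrow> real" where "delta x y = (if y = x then 1 else 0)"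

lemma dot_delta: "x \<in> V \<Longrightarrow> dot f (delta x) = f x"
  using fin by (simp add: dot_def delta_def if_distrib cong: if_cong)

text \<open>For an orthonormal system, the component of the point mass at \<open>x\<close>
  orthogonal to all \<open>u i\<close>. The coefficients 1 and -1 are written out so that
  \<open>dot_lin\<close> applies.\<close>

definition residual :: "nat \<Rightarrow> (nat \<Rightarrow> 'a \<Rightarrow> real) \<Rightarrow> 'a \<Rightarrow> 'a \<Rightarrow> real" where
  "residual r u x = (\<lambda>y. 1 * delta x y + (-1) * (\<Sum>i<r. u i x * u i y))"

lemma residual_dot:
  assumes "x \<in> V"
  shows "dot f (residual r u x) = f x - (\<Sum>i<r. u i x * dot f (u i))"
  unfolding residual_def dot_lin dot_sum using dot_delta[OF assms] by simp

lemma residual_orthogonal: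
  assumes "eigensystem r u l" "x \<in> V" "i < r"
  shows "dot (u i) (residual r u x) = 0"
proof -
  have "(\<Sum>j<r. u j x * dot (u i) (u j)) = (\<Sum>j<r. if j = i then u i x else 0)"
    using assms by (intro sum.cong) (auto simp: eigensystem_def)
  then show ?thesis using assms by (simp add: residual_dot)
qed

lemma residual_norm:
  assumes "eigensystem r u l" "x \<in> V"
  shows "dot (residual r u x) (residual r u x) = 1 - (\<Sum>i<r. (u i x)\<^sup>2)"
  unfolding residual_dot[OF assms(2)]
  using residual_orthogonal[OF assms]
  by (simp add: dot_commute residual_def delta_def power2_eq_square)

text \<open>Bessel's inequality for the point masses, that is nonnegativity of the norm in
  \<open>residual_norm\<close>, summed over \<open>V\<close>.\<close>

lemma eigensystem_card:
  assumes "eigensystem r u l"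
  shows "r \<le> card V"
proof -
  have "real r = (\<Sum>i<r. dot (u i) (u i))" using assms by (simp add: eigensystem_def)
  also have "\<dots> = (\<Sum>x\<in>V. \<Sum>i<r. (u i x)\<^sup>2)"
    unfolding dot_def power2_eq_square by (rule sum.swap)
  also have "\<dots> \<le> (\<Sum>x\<in>V. 1)"
    using residual_norm[OF assms] dot_self_nonneg by (intro sum_mono) (metis diff_ge_0_iff_ge)
  finally show ?thesis by simp
qed

text \<open>As long as some point mass is outside the span, its residual witnesses room for one more
  eigenvector, and \<open>eigensystem_card\<close> makes the recursion on \<open>card V - r\<close>
  terminate. The given eigenvectors are kept, so that the constant vector can later be prescribed as
  the first one.\<close>

lemma eigensystem_complete:
  assumes "eigensystem r u l"
  shows "\<exists>r' u' l'. r \<le> r' \<and> eigensystem r' u' l' \<and> (\<forall>i<r. u' i = u i \<and> l' i = l i) \<and>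
    (\<forall>x\<in>V. \<forall>y\<in>V. (\<Sum>i<r'. u' i x * u' i y) = (if x = y then 1 else 0))"
  using assms
proof (induction "card V - r" arbitrary: r u l rule: less_induct)
  case less
  show ?case
  proof (cases "\<forall>x\<in>V. \<forall>y\<in>V. residual r u x y = 0")
    case True
    then show ?thesis using less(2)
      by (intro exI[of _ r] exI[of _ u] exI[of _ l]) (auto simp: residual_def delta_def mult.commute)
  next
    case False
    then obtain x where x: "x \<in> V" "dot (residual r u x) (residual r u x) \<noteq> 0"
      by (auto simp: dot_self_eq_0)
    obtain g \<theta> where E: "eigensystem (Suc r) (u(r := g)) (l(r := \<theta>))"
      using eigensystem_extend[OF less(2) _ x(2)] residual_orthogonal[OF less(2) x(1)] by blast
    have "card V - Suc r < card V - r" using eigensystem_card[OF E] by simp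
    from less(1)[OF this E] obtain r' u' l' where *: "Suc r \<le> r'" "eigensystem r' u' l'"
      "\<forall>i<Suc r. u' i = (u(r := g)) i \<and> l' i = (l(r := \<theta>)) i"
      "\<forall>x\<in>V. \<forall>y\<in>V. (\<Sum>i<r'. u' i x * u' i y) = (if x = y then 1 else 0)" by blast
    have "\<forall>i<r. u' i = u i \<and> l' i = l i" using *(3) by (metis fun_upd_other less_SucI less_irrefl)
    then show ?thesis using * by (meson Suc_leD)
  qed
qed

end

section \<open>Trace formulas and quadratic forms in a complete eigenbasis\<close>

locale eigenbasis = symmetric_matrix +
  fixes r :: nat and u :: "nat \<Rightarrow> 'a \<Rightarrow> real" and l :: "nat \<Rightarrow> real"
  assumes eigensystem: "eigensystem r u l"
    and completeness: "x \<in> V \<Longrightarrow> y \<in> V \<Longrightarrow> (\<Sum>i<r. u i x * u i y) = (if x = y then 1 else 0)"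
begin

lemma orthonormal: "i < r \<Longrightarrow> j < r \<Longrightarrow> dot (u i) (u j) = (if i = j then 1 else 0)"
  using eigensystem by (simp add: eigensystem_def)

lemma eigenvector: "i < r \<Longrightarrow> x \<in> V \<Longrightarrow> (\<Sum>y\<in>V. A x y * u i y) = l i * u i x"
  using eigensystem by (simp add: eigensystem_def app_def)

text \<open>The eigenvalue equation turns the right side into the product of \<open>A\<close> with
  the matrix of \<open>completeness\<close>, which is the identity.\<close>

lemma entry:
  assumes "x \<in> V" "y \<in> V"
  shows "A x y = (\<Sum>i<r. l i * u i x * u i y)"
proof -
  have "(\<Sum>i<r. l i * u i x * u i y) = (\<Sum>i<r. \<Sum>z\<in>V. A x z * (u i z * u i y))"
    using assms by (intro sum.cong refl) (simp add: eigenvector[symmetric] sum_distrib_right mult.assoc)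
  also have "\<dots> = (\<Sum>z\<in>V. A x z * (\<Sum>i<r. u i z * u i y))"
    unfolding sum_distrib_left by (rule sum.swap)
  also have "\<dots> = (\<Sum>z\<in>V. if z = y then A x y else 0)"
    using assms by (intro sum.cong refl) (simp add: completeness)
  also have "\<dots> = A x y" using assms fin by simp
  finally show ?thesis by simp
qed

text \<open>Used with the weights 1, \<open>l i\<close> and the squares of \<open>l i\<close> to
  obtain the dimension and the two trace identities.\<close>

lemma trace_sum: "(\<Sum>x\<in>V. \<Sum>i<r. c i * u i x * u i x) = (\<Sum>i<r. c i)"
proof -
  have "(\<Sum>x\<in>V. \<Sum>i<r. c i * u i x * u i x) = (\<Sum>i<r. \<Sum>x\<in>V. c i * u i x * u i x)"
    by (rule sum.swap)
  also have "\<dots> = (\<Sum>i<r. c i * dot (u i) (u i))"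
    by (simp add: dot_def sum_distrib_left mult.assoc)
  finally show ?thesis by (simp add: orthonormal)
qed

lemma dimension: "r = card V"
proof -
  have "real r = (\<Sum>x\<in>V. \<Sum>i<r. 1 * u i x * u i x)" unfolding trace_sum by simp
  also have "\<dots> = real (card V)" by (simp add: completeness)
  finally show ?thesis by simp
qed

lemma trace: "(\<Sum>i<r. l i) = (\<Sum>x\<in>V. A x x)"
  by (subst trace_sum[symmetric]) (intro sum.cong refl, simp add: entry)

lemma trace_square: "(\<Sum>i<r. (l i)\<^sup>2) = (\<Sum>x\<in>V. \<Sum>y\<in>V. (A x y)\<^sup>2)"
proof -
  have "(\<Sum>y\<in>V. (A x y)\<^sup>2) = (\<Sum>i<r. (l i)\<^sup>2 * u i x * u i x)" if x: "x \<in> V" for x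
  proof -
    have "(\<Sum>y\<in>V. (A x y)\<^sup>2) = (\<Sum>y\<in>V. \<Sum>i<r. (A x y * u i y) * (l i * u i x))"
    proof (intro sum.cong refl)
      fix y assume "y \<in> V"
      then have "(A x y)\<^sup>2 = A x y * (\<Sum>i<r. l i * u i x * u i y)"
        using x by (simp add: power2_eq_square entry[symmetric])
      then show "(A x y)\<^sup>2 = (\<Sum>i<r. (A x y * u i y) * (l i * u i x))"
        by (simp add: sum_distrib_left mult_ac)
    qed
    also have "\<dots> = (\<Sum>i<r. (\<Sum>y\<in>V. A x y * u i y) * (l i * u i x))"
      unfolding sum_distrib_right by (rule sum.swap)
    also have "\<dots> = (\<Sum>i<r. (l i)\<^sup>2 * u i x * u i x)"
      using x by (intro sum.cong refl) (simp add: eigenvector power2_eq_square mult_ac)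
    finally show ?thesis .
  qed
  then show ?thesis using trace_sum[of "\<lambda>i. (l i)\<^sup>2"] by simp
qed

lemma rayleigh_bound:
  assumes "\<And>i. i < r \<Longrightarrow> -w \<le> l i"
  shows "-w * dot f f \<le> dot f (app f)"
proof -
  \<comment> \<open>Diagonalizes the quadratic form with spectral weights \<open>c\<close>. The
    weights 1 and \<open>l\<close> express both sides of the claim as sums that can be compared term
    by term.\<close>
  have *: "(\<Sum>x\<in>V. \<Sum>y\<in>V. (\<Sum>i<r. c i * u i x * u i y) * f x * f y) = (\<Sum>i<r. c i * (dot (u i) f)\<^sup>2)" for c
  proof -
    have "(\<Sum>x\<in>V. \<Sum>y\<in>V. (\<Sum>i<r. c i * u i x * u i y) * f x * f y) =
        (\<Sum>x\<in>V. \<Sum>y\<in>V. \<Sum>i<r. c i * ((u i x * f x) * (u i y * f y)))"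
      by (simp add: sum_distrib_left sum_distrib_right mult_ac)
    also have "\<dots> = (\<Sum>x\<in>V. \<Sum>i<r. \<Sum>y\<in>V. c i * ((u i x * f x) * (u i y * f y)))"
      by (intro sum.cong refl sum.swap)
    also have "\<dots> = (\<Sum>i<r. \<Sum>x\<in>V. \<Sum>y\<in>V. c i * ((u i x * f x) * (u i y * f y)))"
      by (rule sum.swap)
    also have "\<dots> = (\<Sum>i<r. c i * (dot (u i) f)\<^sup>2)"
      unfolding dot_def power2_eq_square sum_product by (simp only: sum_distrib_left)
    finally show ?thesis .
  qed
  have "dot f f = (\<Sum>x\<in>V. \<Sum>y\<in>V. if x = y then f x * f y else 0)"
    using fin by (simp add: dot_def)
  also have "\<dots> = (\<Sum>x\<in>V. \<Sum>y\<in>V. (\<Sum>i<r. 1 * u i x * u i y) * f x * f y)"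
    by (intro sum.cong refl) (auto simp: completeness)
  finally have 1: "dot f f = (\<Sum>i<r. (dot (u i) f)\<^sup>2)" unfolding * by simp
  have "dot f (app f) = (\<Sum>x\<in>V. \<Sum>y\<in>V. A x y * f x * f y)"
    by (simp add: dot_def app_def sum_distrib_left mult_ac)
  also have "\<dots> = (\<Sum>x\<in>V. \<Sum>y\<in>V. (\<Sum>i<r. l i * u i x * u i y) * f x * f y)"
    by (intro sum.cong refl) (simp add: entry)
  finally have 2: "dot f (app f) = (\<Sum>i<r. l i * (dot (u i) f)\<^sup>2)" unfolding * .
  show ?thesis unfolding 1 2 sum_distrib_left
    using assms by (intro sum_mono mult_right_mono) auto
qed

end

section \<open>Linear dependence and the size of two-distance sets\<close>

lemma homogeneous_system_solution:
  fixes \<phi> :: "'s \<Rightarrow> 'b \<Rightarrow> real"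
  assumes "finite S" "finite N" "card S < card N"
  shows "\<exists>c. (\<exists>y\<in>N. c y \<noteq> 0) \<and> (\<forall>s\<in>S. (\<Sum>y\<in>N. \<phi> s y * c y) = 0)"
  using assms
proof (induction S arbitrary: N \<phi> rule: finite_induct)
  case empty
  then have "N \<noteq> {}" by auto
  then show ?case by (intro exI[of _ "\<lambda>_. 1"]) auto
next
  case (insert s0 S)
  show ?case
  proof (cases "\<forall>y\<in>N. \<phi> s0 y = 0")
    case True
    have "card S < card N" using insert by simp
    from insert.IH[OF insert.prems(1) this, of \<phi>] show ?thesis using True by auto
  next
    case False
    then obtain y0 where y0: "y0 \<in> N" "\<phi> s0 y0 \<noteq> 0" by blast
    let ?N = "N - {y0}"
    have "card S < card ?N" using insert y0 by simp
    \<comment> \<open>Gaussian elimination: equation \<open>s0\<close> removes the unknown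
      \<open>y0\<close> from the remaining equations.\<close>
    from insert.IH[OF _ this, of "\<lambda>s y. \<phi> s y - \<phi> s y0 * \<phi> s0 y / \<phi> s0 y0"]
    obtain c where c: "\<exists>y\<in>?N. c y \<noteq> 0"
      "\<And>s. s \<in> S \<Longrightarrow> (\<Sum>y\<in>?N. (\<phi> s y - \<phi> s y0 * \<phi> s0 y / \<phi> s0 y0) * c y) = 0"
      using insert.prems(1) by auto
    \<comment> \<open>The value of the unknown \<open>y0\<close> for which equation
      \<open>s0\<close> holds.\<close>
    define t where "t = - (\<Sum>y\<in>?N. \<phi> s0 y * c y) / \<phi> s0 y0"
    have split: "(\<Sum>y\<in>N. \<phi> s y * (c(y0 := t)) y) = \<phi> s y0 * t + (\<Sum>y\<in>?N. \<phi> s y * c y)" for s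
      using insert.prems(1) y0(1) by (subst sum.remove[of N y0]) auto
    have "(\<Sum>y\<in>N. \<phi> s y * (c(y0 := t)) y) = 0" if "s \<in> S" for s
    proof -
      have "(\<Sum>y\<in>?N. \<phi> s y * c y) - (\<Sum>y\<in>?N. \<phi> s y0 / \<phi> s0 y0 * (\<phi> s0 y * c y)) = 0"
        using c(2)[OF that] by (simp add: sum_subtractf[symmetric] algebra_simps)
      then show ?thesis unfolding split sum_distrib_left[symmetric] by (simp add: t_def)
    qed
    moreover have "(\<Sum>y\<in>N. \<phi> s0 y * (c(y0 := t)) y) = 0"
      unfolding split using y0(2) by (simp add: t_def)
    moreover have "\<exists>y\<in>N. (c(y0 := t)) y \<noteq> 0" using c(1) by auto
    ultimately show ?thesis by blast
  qed
qed

text \<open>A rank argument: if \<open>N\<close> were larger than \<open>S\<close>, some nonzero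
  vector would be annihilated by \<open>\<phi>\<close>, hence by the whole product, which is a
  nonzero multiple of the identity.\<close>

lemma diagonal_rank:
  fixes \<phi> \<psi> :: "'s \<Rightarrow> 'b \<Rightarrow> real"
  assumes "finite S" "finite N" "d \<noteq> 0"
    and F: "\<And>y z. y \<in> N \<Longrightarrow> z \<in> N \<Longrightarrow> (\<Sum>s\<in>S. \<phi> s y * \<psi> s z) = (if y = z then d else 0)"
  shows "card N \<le> card S"
proof (rule ccontr)
  assume "\<not> ?thesis"
  then obtain c where c: "\<exists>y\<in>N. c y \<noteq> 0" "\<forall>s\<in>S. (\<Sum>y\<in>N. \<phi> s y * c y) = 0"
    using homogeneous_system_solution[OF assms(1,2), of \<phi>] by auto
  have "d * c z = 0" if z: "z \<in> N" for z
  proof -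
    have "d * c z = (\<Sum>y\<in>N. (\<Sum>s\<in>S. \<phi> s y * \<psi> s z) * c y)"
      using z assms(2) by (simp add: F if_distrib[of "\<lambda>t. t * _"] cong: if_cong)
    also have "\<dots> = (\<Sum>y\<in>N. \<Sum>s\<in>S. (\<phi> s y * c y) * \<psi> s z)"
      by (simp add: sum_distrib_left sum_distrib_right mult_ac)
    also have "\<dots> = (\<Sum>s\<in>S. (\<Sum>y\<in>N. \<phi> s y * c y) * \<psi> s z)"
      unfolding sum_distrib_right by (rule sum.swap)
    also have "\<dots> = 0" using c(2) by simp
    finally show ?thesis .
  qed
  then show False using c(1) assms(3) by simp
qed

text \<open>With \<open>E\<close> the Gram matrix, the entrywise product of \<open>E - \<alpha>\<close> and \<open>E - \<beta>\<close> has rank at most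
  \<open>(card I + 1)\<^sup>2\<close>, but is a nonzero multiple of the identity.\<close>

lemma two_distance_set_bound:
  fixes g :: "'s \<Rightarrow> 'b \<Rightarrow> real"
  assumes fin: "finite I" "finite N" and ne: "\<gamma> \<noteq> \<alpha>" "\<gamma> \<noteq> \<beta>"
    and diag: "\<And>y. y \<in> N \<Longrightarrow> (\<Sum>i\<in>I. g i y * g i y) = \<gamma>"
    and off: "\<And>y z. y \<in> N \<Longrightarrow> z \<in> N \<Longrightarrow> y \<noteq> z \<Longrightarrow> (\<Sum>i\<in>I. g i y * g i z) \<in> {\<alpha>, \<beta>}"
  shows "card N \<le> (card I + 1)\<^sup>2"
proof -
  \<comment> \<open>The extra index \<open>None\<close> carries a constant coordinate, so that
    subtracting \<open>t\<close> from every Gram entry still leaves a bilinear expression, now in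
    \<open>card I + 1\<close> coordinates.\<close>
  define J where "J = insert None (Some ` I)"
  define h where "h = (\<lambda>t j y. case j of None \<Rightarrow> - t | Some i \<Rightarrow> g i y)"
  define e where "e = (\<lambda>j z. case j of None \<Rightarrow> 1 | Some i \<Rightarrow> g i z)"
  have J: "finite J" "card J = card I + 1"
    using fin by (auto simp: J_def card_image)
  have h: "(\<Sum>j\<in>J. h t j y * e j z) = (\<Sum>i\<in>I. g i y * g i z) - t" for t y z
    using fin by (simp add: J_def h_def e_def sum.reindex)
  have "card N \<le> card (J \<times> J)"
  proof (rule diagonal_rank)
    show "(\<gamma> - \<alpha>) * (\<gamma> - \<beta>) \<noteq> 0" using ne by simp
    fix y z assume yz: "y \<in> N" "z \<in> N"
    have "(\<Sum>s\<in>J \<times> J. (h \<alpha> (fst s) y * h \<beta> (snd s) y) * (e (fst s) z * e (snd s) z)) =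
        (\<Sum>i\<in>J. \<Sum>j\<in>J. (h \<alpha> i y * e i z) * (h \<beta> j y * e j z))"
      by (simp add: sum.cartesian_product case_prod_beta mult_ac)
    also have "\<dots> = ((\<Sum>i\<in>I. g i y * g i z) - \<alpha>) * ((\<Sum>i\<in>I. g i y * g i z) - \<beta>)"
      unfolding h[symmetric] by (simp add: sum_product)
    also have "\<dots> = (if y = z then (\<gamma> - \<alpha>) * (\<gamma> - \<beta>) else 0)"
      using diag off[OF yz] yz by auto
    finally show "(\<Sum>s\<in>J \<times> J. (h \<alpha> (fst s) y * h \<beta> (snd s) y) * (e (fst s) z * e (snd s) z)) =
        (if y = z then (\<gamma> - \<alpha>) * (\<gamma> - \<beta>) else 0)" .
  qed (use J fin in auto)
  then show ?thesis using J by (simp add: card_cartesian_product power2_eq_square)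
qed

section \<open>Two-walk-regular graphs and their eigenspaces\<close>

text \<open>Links functions on vertices to the matrix spectrum: an eigenfunction read along
  \<open>vertex_list\<close> is an eigenvector, and the minimum of the finite spectrum is at most
  its eigenvalue.\<close>

lemma smallest_eigenvalue_le:
  assumes G: "pair_graph G"
    and f: "x0 \<in> pverts G" "f x0 \<noteq> 0"
    and ev: "\<And>x. x \<in> pverts G \<Longrightarrow> (\<Sum>y\<in>pverts G. (if (x, y) \<in> parcs G then 1 else 0) * f y) = \<mu> * f x"
  shows "smallest_eigenvalue G \<le> \<mu>"
proof -
  interpret pair_graph G by (rule G)
  define vs where "vs = vertex_list G"
  define n where "n = length vs"
  have "\<exists>vs. set vs = pverts G \<and> distinct vs"
    using finite_distinct_list[OF pair_finite_verts] .
  then have "set vs = pverts G \<and> distinct vs"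
    unfolding vs_def vertex_list_def by (rule someI_ex)
  then have vs: "set vs = pverts G" "distinct vs" by blast+
  have nth: "vs ! i \<in> pverts G" if "i < n" for i
    using nth_mem[of i vs] that unfolding vs(1) n_def .
  have bij: "bij_betw ((!) vs) {0..<n} (pverts G)"
    unfolding atLeast0LessThan by (rule bij_betw_nth[OF vs(2)]) (use vs(1) in \<open>simp_all add: n_def\<close>)
  define M where "M = adjacency_matrix G"
  have M: "M = mat n n (\<lambda>(i, j). if (vs ! i, vs ! j) \<in> parcs G then 1 else 0)"
    by (simp add: M_def adjacency_matrix_def Let_def vs_def n_def)
  define v where "v = vec n (\<lambda>i. f (vs ! i))"
  have "M *\<^sub>v v = \<mu> \<cdot>\<^sub>v v"
  proof (rule eq_vecI)
    fix i assume "i < dim_vec (\<mu> \<cdot>\<^sub>v v)"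
    then have i: "i < n" by (simp add: v_def)
    have "(M *\<^sub>v v) $ i = (\<Sum>j = 0..<n. (if (vs ! i, vs ! j) \<in> parcs G then 1 else 0) * f (vs ! j))"
      using i by (simp add: M v_def scalar_prod_def)
    also have "\<dots> = (\<Sum>y\<in>pverts G. (if (vs ! i, y) \<in> parcs G then 1 else 0) * f y)"
      by (rule sum.reindex_bij_betw[OF bij])
    also have "\<dots> = \<mu> * f (vs ! i)" using ev nth[OF i] .
    finally show "(M *\<^sub>v v) $ i = (\<mu> \<cdot>\<^sub>v v) $ i" using i by (simp add: v_def)
  qed (simp add: M v_def)
  moreover have "v \<noteq> 0\<^sub>v n"
  proof
    assume "v = 0\<^sub>v n"
    moreover obtain i where "i < n" "vs ! i = x0"
      using f(1) vs(1) by (metis in_set_conv_nth n_def)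
    ultimately show False using f(2) by (metis index_vec index_zero_vec(1) v_def)
  qed
  ultimately have "eigenvalue M \<mu>"
    unfolding eigenvalue_def eigenvector_def by (intro exI[of _ v]) (auto simp: M v_def)
  then have "\<mu> \<in> spectrum M" by (simp add: spectrum_def)
  moreover have "finite (spectrum M)"
    by (rule card_finite_spectrum(1)[of _ n]) (simp add: M)
  ultimately show ?thesis by (simp add: smallest_eigenvalue_def M_def[symmetric])
qed

locale two_walk_regular_graph = pair_graph G for G :: "'a pair_pre_digraph" +
  assumes two_walk_regular: "two_walk_regular G"
begin

definition adj :: "'a \<Rightarrow> 'a \<Rightarrow> real" where
  "adj x y = (if (x, y) \<in> parcs G then 1 else 0)"

definition nbrs :: "'a \<Rightarrow> 'a set" where
  "nbrs x = {y. (x, y) \<in> parcs G}"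

sublocale adjm: symmetric_matrix "pverts G" adj
  by unfold_locales (auto simp: adj_def intro: arcs_symmetric)

lemma in_nbrs [simp]: "y \<in> nbrs x \<longleftrightarrow> (x, y) \<in> parcs G"
  by (simp add: nbrs_def)

lemma nbrs_subset: "nbrs x \<subseteq> pverts G"
  by (auto dest: in_arcsD2)

lemma finite_nbrs: "finite (nbrs x)"
  using nbrs_subset finite_subset pair_finite_verts by blast

lemma arc_verts: "(x, y) \<in> parcs G \<Longrightarrow> x \<in> pverts G" "(x, y) \<in> parcs G \<Longrightarrow> y \<in> pverts G"
  by (auto dest: in_arcsD1 in_arcsD2)

lemma arc_irrefl: "(x, x) \<notin> parcs G"
  using no_loops by force

lemma sum_adj: "(\<Sum>y\<in>pverts G. adj x y * f y) = (\<Sum>y\<in>nbrs x. f y)"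
proof -
  have "(\<Sum>y\<in>nbrs x. f y) = (\<Sum>y\<in>nbrs x. adj x y * f y)"
    by (intro sum.cong) (auto simp: adj_def)
  also have "\<dots> = (\<Sum>y\<in>pverts G. adj x y * f y)"
    by (rule sum.mono_neutral_left) (use nbrs_subset in \<open>auto simp: adj_def\<close>)
  finally show ?thesis ..
qed

lemma common_neighbors_eq: "common_neighbors G x y = nbrs x \<inter> nbrs y"
  by (auto simp: common_neighbors_def dest: arc_verts)

lemma card_nbrs:
  assumes "x \<in> pverts G"
  shows "card (nbrs x) = valency G"
proof -
  have "out_degree (with_proj G) x = valency G"
    using theI'[OF ex1_valency[OF two_walk_regular]] assms unfolding valency_def by blast
  then show ?thesis
    using assms out_degree_eq_num_walks[OF pair_graph_axioms] num_walks_2[OF pair_graph_axioms]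
    by (simp add: common_neighbors_eq)
qed

lemma card_common_adjacent:
  "(x, y) \<in> parcs G \<Longrightarrow> card (nbrs x \<inter> nbrs y) = a1 G"
  using theI'[OF ex1_a1[OF two_walk_regular], folded a1_def] arc_verts[of x y]
  unfolding common_neighbors_eq by blast

lemma card_common_dist_2:
  "x \<in> pverts G \<Longrightarrow> y \<in> pverts G \<Longrightarrow> graph_dist G x y = 2 \<Longrightarrow> card (nbrs x \<inter> nbrs y) = c2 G"
  using theI'[OF ex1_c2[OF two_walk_regular], folded c2_def]
  unfolding common_neighbors_eq by blast

lemma dist_le: "awalk x p y \<Longrightarrow> graph_dist G x y \<le> length p"
  unfolding graph_dist_def by (rule Least_le) blast

lemma dist_walk:
  assumes "x \<in> pverts G" "y \<in> pverts G"
  obtains p where "awalk x p y" "length p = graph_dist G x y"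
  using reachable_dist[OF pair_graph_axioms _ assms] two_walk_regular
  by (auto simp: two_walk_regular_def)

lemma arc_walk: "(x, y) \<in> parcs G \<Longrightarrow> awalk x [(x, y)] y"
  by (auto simp: awalk_simps dest: arc_verts)

lemma dist_step:
  assumes "x \<in> pverts G" "(y, z) \<in> parcs G"
  shows "graph_dist G x z \<le> Suc (graph_dist G x y)"
proof -
  obtain p where p: "awalk x p y" "length p = graph_dist G x y"
    using dist_walk assms arc_verts by metis
  have "awalk x (p @ [(y, z)]) z" using p(1) arc_walk[OF assms(2)] by (rule awalk_appendI)
  from dist_le[OF this] show ?thesis using p(2) by simp
qed

lemma dist_pred:
  assumes "x \<in> pverts G" "z \<in> pverts G" "graph_dist G x z = Suc i"
  obtains y where "(y, z) \<in> parcs G" "graph_dist G x y = i"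
proof -
  obtain p where p: "awalk x p z" "length p = Suc i"
    using dist_walk[OF assms(1,2)] assms(3) by metis
  then obtain q e where qe: "p = q @ [e]" by (metis Zero_not_Suc length_0_conv rev_exhaust)
  obtain y where y: "awalk x q y" "awalk y [e] z"
    using p(1) unfolding qe awalk_append_iff by blast
  then have arc: "(y, z) \<in> parcs G" by (cases e) (auto simp: awalk_simps)
  have "graph_dist G x y \<le> i" using dist_le[OF y(1)] p(2) qe by simp
  moreover have "Suc i \<le> Suc (graph_dist G x y)" using dist_step[OF assms(1) arc] assms(3) by simp
  ultimately show ?thesis using that[OF arc] by simp
qed

lemma dist_eq_0: "x \<in> pverts G \<Longrightarrow> y \<in> pverts G \<Longrightarrow> graph_dist G x y = 0 \<Longrightarrow> x = y"
  by (metis awalk_Nil_iff dist_walk length_0_conv)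

lemma dist_eq_1:
  "x \<in> pverts G \<Longrightarrow> y \<in> pverts G \<Longrightarrow> graph_dist G x y = 1 \<Longrightarrow> (x, y) \<in> parcs G"
  using dist_pred[of x y 0] dist_eq_0[of x] arc_verts(1) by (metis One_nat_def)

lemma dist_eq_2:
  assumes "(x, t) \<in> parcs G" "(t, y) \<in> parcs G" "x \<noteq> y" "(x, y) \<notin> parcs G"
  shows "graph_dist G x y = 2"
proof -
  have v: "x \<in> pverts G" "y \<in> pverts G" using assms arc_verts by blast+
  have "graph_dist G x y \<le> 2"
    using dist_step[OF v(1) assms(2)] graph_dist_arc[OF pair_graph_axioms assms(1)] by simp
  moreover have "graph_dist G x y \<noteq> 0" using dist_eq_0[OF v] assms(3) by blast
  moreover have "graph_dist G x y \<noteq> 1" using dist_eq_1[OF v] assms(4) by blast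
  ultimately show ?thesis by linarith
qed

lemma finite_dists: "finite {graph_dist G x y | x y. x \<in> pverts G \<and> y \<in> pverts G}"
  by (rule finite_subset[of _ "(\<lambda>(x, y). graph_dist G x y) ` (pverts G \<times> pverts G)"])
     (use pair_finite_verts in auto)

lemma dist_le_diameter:
  "x \<in> pverts G \<Longrightarrow> y \<in> pverts G \<Longrightarrow> graph_dist G x y \<le> diameter G"
  unfolding diameter_def using finite_dists by (intro Max_ge) auto

lemma nonempty: "pverts G \<noteq> {}"
  using ex_dist_2[OF two_walk_regular] by auto

lemma diameter_attained:
  obtains x y where "x \<in> pverts G" "y \<in> pverts G" "graph_dist G x y = diameter G"
proof -
  have "diameter G \<in> {graph_dist G x y | x y. x \<in> pverts G \<and> y \<in> pverts G}"
    unfolding diameter_def using finite_dists nonempty by (intro Max_in) auto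
  then show ?thesis using that by auto
qed

lemma num_walks_0: "x \<in> pverts G \<Longrightarrow> num_walks G 0 x y = (if x = y then 1 else 0)"
proof -
  assume "x \<in> pverts G"
  then have "{p. awalk x p y \<and> length p = 0} = (if x = y then {[]} else {})"
    by (auto simp: awalk_Nil_iff)
  then show ?thesis by (simp add: num_walks_def)
qed

lemma finite_walks: "finite {p. awalk x p y \<and> length p = j}"
  by (rule finite_subset[OF _ finite_lists_length_eq[OF pair_finite_arcs, of j]]) auto

lemma num_walks_Suc: "num_walks G (Suc j) x y = (\<Sum>z\<in>nbrs x. num_walks G j z y)"
proof -
  have "{p. awalk x p y \<and> length p = Suc j} =
      (\<Union>z\<in>nbrs x. Cons (x, z) ` {p. awalk z p y \<and> length p = j})"
    by (auto simp: length_Suc_conv awalk_Cons_iff image_iff)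
  then have "num_walks G (Suc j) x y =
      card (\<Union>z\<in>nbrs x. Cons (x, z) ` {p. awalk z p y \<and> length p = j})"
    by (simp add: num_walks_def)
  also have "\<dots> = (\<Sum>z\<in>nbrs x. card (Cons (x, z) ` {p. awalk z p y \<and> length p = j}))"
    by (rule card_UN_disjoint) (use finite_nbrs finite_walks in auto)
  also have "\<dots> = (\<Sum>z\<in>nbrs x. num_walks G j z y)"
    by (simp add: num_walks_def card_image)
  finally show ?thesis .
qed

lemma num_walks_dist:
  assumes "x \<in> pverts G" "y \<in> pverts G" "x' \<in> pverts G" "y' \<in> pverts G"
    and "graph_dist G x y \<le> 2" "graph_dist G x' y' = graph_dist G x y"
  shows "num_walks G j x' y' = num_walks G j x y"
  using two_walk_regular assms unfolding two_walk_regular_def by blast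

lemma constant_along_arcs:
  assumes f: "\<And>x y. (x, y) \<in> parcs G \<Longrightarrow> f x = f y"
    and "x \<in> pverts G" "y \<in> pverts G"
  shows "f x = f y"
proof -
  have "awalk x p y \<Longrightarrow> f x = f y" for p
  proof (induction p arbitrary: x)
    case Nil
    then show ?case by (simp add: awalk_Nil_iff)
  next
    case (Cons e p)
    then have "(x, snd e) \<in> parcs G" "awalk (snd e) p y"
      by (auto simp: awalk_Cons_iff)
    then show ?case using f Cons.IH by metis
  qed
  then show ?thesis using dist_walk[OF assms(2,3)] by blast
qed

end

section \<open>The spectrum of a two-walk-regular graph\<close>

text \<open>Index 0 is reserved for a constant vector, with the valency as its eigenvalue, so that
  the other eigenvalues are those with positive index.\<close>

locale walk_regular_eigenbasis = two_walk_regular_graph G +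
  eigenbasis "pverts G" "two_walk_regular_graph.adj G" r u l
  for G :: "'a pair_pre_digraph" and r :: nat and u :: "nat \<Rightarrow> 'a \<Rightarrow> real" and l :: "nat \<Rightarrow> real" +
  fixes c :: real
  assumes r_pos: "0 < r" and c_nonzero: "c \<noteq> 0"
    and u_0: "x \<in> pverts G \<Longrightarrow> u 0 x = c" and l_0: "l 0 = real (valency G)"
begin

lemma eigenvector_nbrs:
  assumes "i < r" "x \<in> pverts G"
  shows "(\<Sum>y\<in>nbrs x. u i y) = l i * u i x"
  using eigenvector[OF assms] by (simp add: sum_adj)

lemma sum_eigenvalues: "(\<Sum>i<r. l i) = 0"
  unfolding trace by (simp add: adj_def arc_irrefl)

lemma sum_eigenvalues_square: "(\<Sum>i<r. (l i)\<^sup>2) = real (card (pverts G)) * real (valency G)"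
proof -
  have "(\<Sum>y\<in>pverts G. (adj x y)\<^sup>2) = real (valency G)" if "x \<in> pverts G" for x
  proof -
    have "(\<Sum>y\<in>pverts G. (adj x y)\<^sup>2) = (\<Sum>y\<in>nbrs x. adj x y)"
      by (simp add: power2_eq_square sum_adj)
    also have "\<dots> = real (card (nbrs x))" by (simp add: adj_def)
    finally show ?thesis using card_nbrs[OF that] by simp
  qed
  then show ?thesis by (simp add: trace_square)
qed

text \<open>Walk counts are entries of powers of the adjacency matrix; splitting off the first arc
  multiplies each spectral term by \<open>l i\<close>.\<close>

lemma num_walks_spectral:
  assumes "x \<in> pverts G" "y \<in> pverts G"
  shows "real (num_walks G j x y) = (\<Sum>i<r. l i ^ j * u i x * u i y)"
  using assms(1)
proof (induction j arbitrary: x)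
  case 0
  then show ?case using assms(2) by (simp add: num_walks_0 completeness)
next
  case (Suc j)
  have "real (num_walks G (Suc j) x y) = (\<Sum>z\<in>nbrs x. \<Sum>i<r. l i ^ j * u i z * u i y)"
    using Suc.IH nbrs_subset by (simp add: num_walks_Suc subset_iff)
  also have "\<dots> = (\<Sum>i<r. \<Sum>z\<in>nbrs x. l i ^ j * u i z * u i y)"
    by (rule sum.swap)
  also have "\<dots> = (\<Sum>i<r. l i ^ j * (\<Sum>z\<in>nbrs x. u i z) * u i y)"
    by (simp add: sum_distrib_left sum_distrib_right)
  also have "\<dots> = (\<Sum>i<r. l i ^ Suc j * u i x * u i y)"
    using Suc.prems by (intro sum.cong refl) (simp add: eigenvector_nbrs mult_ac)
  finally show ?case .
qed

text \<open>The valency is a simple eigenvalue by connectedness: for an eigenvector of it, the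
  squared differences along arcs sum to 0, so it is constant, and a constant vector orthogonal to
  \<open>u 0\<close> vanishes.\<close>

lemma eigenvalue_ne_valency:
  assumes "0 < i" "i < r"
  shows "l i \<noteq> real (valency G)"
proof
  assume li: "l i = real (valency G)"
  have nb: "(\<Sum>y\<in>nbrs x. (u i x)\<^sup>2) = real (valency G) * (u i x)\<^sup>2" if "x \<in> pverts G" for x
    using card_nbrs[OF that] by simp
  \<comment> \<open>Symmetry of \<open>adj\<close> exchanges the two ends of each arc.\<close>
  have sw: "(\<Sum>x\<in>pverts G. \<Sum>y\<in>nbrs x. (u i y)\<^sup>2) = (\<Sum>x\<in>pverts G. \<Sum>y\<in>nbrs x. (u i x)\<^sup>2)"
  proof -
    have "(\<Sum>x\<in>pverts G. \<Sum>y\<in>nbrs x. (u i y)\<^sup>2) = (\<Sum>x\<in>pverts G. \<Sum>y\<in>pverts G. adj x y * (u i y)\<^sup>2)"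
      by (simp add: sum_adj)
    also have "\<dots> = (\<Sum>y\<in>pverts G. \<Sum>x\<in>pverts G. adj x y * (u i y)\<^sup>2)" by (rule sum.swap)
    also have "\<dots> = (\<Sum>y\<in>pverts G. \<Sum>x\<in>pverts G. adj y x * (u i y)\<^sup>2)"
      by (intro sum.cong refl) (simp add: adjm.sym)
    finally show ?thesis by (simp add: sum_adj)
  qed
  have "(\<Sum>x\<in>pverts G. \<Sum>y\<in>nbrs x. (u i x - u i y)\<^sup>2) =
      (\<Sum>x\<in>pverts G. \<Sum>y\<in>nbrs x. (u i x)\<^sup>2) + (\<Sum>x\<in>pverts G. \<Sum>y\<in>nbrs x. (u i y)\<^sup>2)
      - 2 * (\<Sum>x\<in>pverts G. u i x * (\<Sum>y\<in>nbrs x. u i y))"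
    by (simp add: power2_diff sum.distrib sum_subtractf sum_distrib_left mult_ac)
  also have "\<dots> = 0"
  proof -
    have "(\<Sum>x\<in>pverts G. \<Sum>y\<in>nbrs x. (u i x)\<^sup>2) = (\<Sum>x\<in>pverts G. real (valency G) * (u i x)\<^sup>2)"
      by (intro sum.cong refl nb)
    moreover have "(\<Sum>x\<in>pverts G. u i x * (\<Sum>y\<in>nbrs x. u i y)) =
        (\<Sum>x\<in>pverts G. real (valency G) * (u i x)\<^sup>2)"
      using assms by (intro sum.cong refl) (simp add: eigenvector_nbrs li power2_eq_square)
    ultimately show ?thesis unfolding sw by linarith
  qed
  finally have "\<forall>x\<in>pverts G. \<forall>y\<in>nbrs x. (u i x - u i y)\<^sup>2 = 0"
    using pair_finite_verts finite_nbrs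
    by (simp add: sum_nonneg_eq_0_iff sum_nonneg)
  then have "u i x = u i y" if "(x, y) \<in> parcs G" for x y using that arc_verts by simp
  then have const: "u i x = u i y" if "x \<in> pverts G" "y \<in> pverts G" for x y
    using constant_along_arcs[of "u i"] that by blast
  obtain x where x: "x \<in> pverts G" using nonempty by blast
  have "adjm.dot (u i) (u 0) = (\<Sum>y\<in>pverts G. u i x * c)"
    unfolding adjm.dot_def by (intro sum.cong refl) (simp add: const[OF _ x] u_0)
  then have "u i x * c = 0"
    using orthonormal[OF assms(2) r_pos] assms(1) nonempty pair_finite_verts by simp
  then have "\<forall>y\<in>pverts G. u i y = 0" using c_nonzero const x by (metis mult_eq_0_iff)
  then have "adjm.dot (u i) (u i) = 0" by (simp add: adjm.dot_def)
  then show False using orthonormal assms by simp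
qed

lemma large_eigenvalue:
  assumes n: "2 * valency G + 2 \<le> card (pverts G)"
    and w: "\<And>i. i < r \<Longrightarrow> - w \<le> l i" "1 \<le> w" "w \<le> real (valency G)"
  obtains i where "0 < i" "i < r" "real (valency G) - w \<le> 2 * w * l i"
proof -
  define T where "T = {..<r} - {0}"
  define k where "k = real (valency G)"
  define n where "n = real (card (pverts G))"
  have n2: "2 * k + 2 \<le> n" using n by (simp add: n_def k_def)
  have T: "finite T" "real (card T) = n - 1"
    using r_pos dimension by (auto simp: T_def n_def)
  have split: "(\<Sum>i<r. f i) = f 0 + sum f T" for f :: "nat \<Rightarrow> real"
    unfolding T_def using r_pos by (subst sum.remove[of _ 0]) auto
  have s1: "sum l T = -k" using split[of l] sum_eigenvalues by (simp add: l_0 k_def)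
  have s2: "(\<Sum>i\<in>T. (l i)\<^sup>2) = n * k - k\<^sup>2"
    using split[of "\<lambda>i. (l i)\<^sup>2"] sum_eigenvalues_square by (simp add: l_0 k_def n_def)
  have "T \<noteq> {}" using T n2 by (auto simp: k_def)
  define \<theta> where "\<theta> = Max (l ` T)"
  have "\<theta> \<in> l ` T" unfolding \<theta>_def using T \<open>T \<noteq> {}\<close> by (intro Max_in) auto
  then obtain i where i: "i \<in> T" "l i = \<theta>" by auto
  have "0 \<le> (\<Sum>i\<in>T. (l i + w) * (\<theta> - l i))"
  proof (intro sum_nonneg mult_nonneg_nonneg)
    fix j assume j: "j \<in> T"
    then show "0 \<le> l j + w" using w(1)[of j] by (simp add: T_def)
    show "0 \<le> \<theta> - l j" unfolding \<theta>_def using T j by simp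
  qed
  also have "(\<Sum>i\<in>T. (l i + w) * (\<theta> - l i)) = (\<Sum>i\<in>T. (\<theta> - w) * l i - (l i)\<^sup>2 + w * \<theta>)"
    by (intro sum.cong refl) (simp add: algebra_simps power2_eq_square)
  also have "\<dots> = (\<theta> - w) * (-k) - (n * k - k\<^sup>2) + (n - 1) * (w * \<theta>)"
    using T(2) by (simp add: sum.distrib sum_subtractf sum_distrib_left[symmetric] s1 s2)
  finally have key: "n * k - k * k - w * k \<le> \<theta> * ((n - 1) * w - k)"
    by (simp add: algebra_simps power2_eq_square)
  have kw: "0 \<le> k" "0 \<le> k - w" using w by (auto simp: k_def)
  have "k - w \<le> 2 * w * \<theta>"
  proof (rule ccontr)
    assume "\<not> ?thesis"
    then have *: "2 * w * \<theta> < k - w" by simp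
    \<comment> \<open>The coefficient of \<open>\<theta>\<close> in \<open>key\<close> is positive,
      so the assumed upper bound on \<open>\<theta>\<close> may be inserted there.\<close>
    have "(2 * k + 1) * w \<le> (n - 1) * w" using n2 w(2) by (intro mult_right_mono) auto
    moreover have "k < (2 * k + 1) * w"
    proof -
      have "k < (2 * k + 1) * 1" using kw by simp
      also have "\<dots> \<le> (2 * k + 1) * w" using w(2) kw by (intro mult_left_mono) auto
      finally show ?thesis .
    qed
    ultimately have M: "0 < (n - 1) * w - k" by simp
    have "2 * w * (n * k - k * k - w * k) \<le> 2 * w * \<theta> * ((n - 1) * w - k)"
      using key w(2) by (simp add: mult.assoc)
    also have "\<dots> < (k - w) * ((n - 1) * w - k)" using * M by (rule mult_strict_right_mono)
    also have "\<dots> \<le> (k - w) * (n * w)"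
      using kw w(2) by (intro mult_left_mono) (auto simp: algebra_simps)
    finally have "w * (2 * (n * k - k * k - w * k)) < w * ((k - w) * n)" by (simp add: mult_ac)
    then have "2 * (n * k - k * k - w * k) < (k - w) * n" using w(2) by (subst (asm) mult_less_cancel_left_pos) auto
    \<comment> \<open>After cancelling \<open>w\<close>, the preceding inequality amounts to
      \<open>(k + w) * n < (k + w) * (2 * k)\<close>, against
      \<open>n \<ge> 2 * k + 2\<close>.\<close>
    moreover have "(k + w) * (2 * k) \<le> (k + w) * n" using n2 kw w(2) by (intro mult_left_mono) auto
    ultimately show False by (simp add: algebra_simps)
  qed
  then show ?thesis using that[of i] i by (auto simp: T_def k_def)
qed

text \<open>The projection onto an eigenspace is a polynomial in the adjacency matrix, so that its
  entries inherit 2-walk-regularity.\<close>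

lemma eigenspace_projection_dist:
  assumes "x \<in> pverts G" "y \<in> pverts G" "x' \<in> pverts G" "y' \<in> pverts G"
    and "graph_dist G x y \<le> 2" "graph_dist G x' y' = graph_dist G x y"
  shows "(\<Sum>i | i < r \<and> l i = \<theta>. u i x' * u i y') = (\<Sum>i | i < r \<and> l i = \<theta>. u i x * u i y)"
proof -
  \<comment> \<open>Lagrange interpolation on the distinct eigenvalues: the value is 1 at
    \<open>\<theta>\<close> and 0 at every other one.\<close>
  define p where "p = (\<Prod>\<mu>\<in>l ` {..<r} - {\<theta>}. [:- \<mu> / (\<theta> - \<mu>), 1 / (\<theta> - \<mu>):])"
  have p: "poly p (l i) = (if l i = \<theta> then 1 else 0)" if "i < r" for i
  proof (cases "l i = \<theta>")
    case True
    have "- \<mu> / (\<theta> - \<mu>) + \<theta> / (\<theta> - \<mu>) = 1" if "\<mu> \<noteq> \<theta>" for \<mu>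
      using that by (simp add: diff_divide_distrib[symmetric])
    then show ?thesis using True by (auto simp: p_def poly_prod intro!: prod.neutral)
  next
    case False
    then have "\<exists>\<mu>\<in>l ` {..<r} - {\<theta>}. poly [:- \<mu> / (\<theta> - \<mu>), 1 / (\<theta> - \<mu>):] (l i) = 0"
      using that by (intro bexI[of _ "l i"]) auto
    then show ?thesis using False by (auto simp: p_def poly_prod)
  qed
  have "(\<Sum>i | i < r \<and> l i = \<theta>. u i x * u i y) = (\<Sum>j\<le>Polynomial.degree p. poly.coeff p j * real (num_walks G j x y))"
    if "x \<in> pverts G" "y \<in> pverts G" for x y
  proof -
    have "(\<Sum>j\<le>Polynomial.degree p. poly.coeff p j * real (num_walks G j x y)) =
        (\<Sum>j\<le>Polynomial.degree p. \<Sum>i<r. poly.coeff p j * l i ^ j * (u i x * u i y))"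
      using that by (simp add: num_walks_spectral sum_distrib_left mult_ac)
    also have "\<dots> = (\<Sum>i<r. \<Sum>j\<le>Polynomial.degree p. poly.coeff p j * l i ^ j * (u i x * u i y))"
      by (rule sum.swap)
    also have "\<dots> = (\<Sum>i<r. poly p (l i) * (u i x * u i y))"
      by (simp add: Polynomial.poly_altdef sum_distrib_right)
    also have "\<dots> = (\<Sum>i<r. if l i = \<theta> then u i x * u i y else 0)"
      by (intro sum.cong) (auto simp: p)
    also have "\<dots> = (\<Sum>i | i < r \<and> l i = \<theta>. u i x * u i y)"
      by (subst sum.inter_filter[symmetric]) auto
    finally show ?thesis ..
  qed
  then show ?thesis using assms num_walks_dist[OF assms] by simp
qed

text \<open>The trace of the squared adjacency matrix dominates the contribution of a single
  eigenvalue.\<close>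

lemma card_eigenspace_le:
  "real (card {i. i < r \<and> l i = \<theta>}) * \<theta>\<^sup>2 \<le> real (card (pverts G)) * real (valency G)"
proof -
  have "real (card {i. i < r \<and> l i = \<theta>}) * \<theta>\<^sup>2 = (\<Sum>i | i < r \<and> l i = \<theta>. (l i)\<^sup>2)" by simp
  also have "\<dots> \<le> (\<Sum>i<r. (l i)\<^sup>2)" by (intro sum_mono2) auto
  finally show ?thesis by (simp add: sum_eigenvalues_square)
qed

text \<open>Distinct neighbours of \<open>x0\<close> are adjacent or at distance 2, so their
  projections have common squared norm \<open>\<gamma>\<close> and only the inner products
  \<open>\<alpha>\<close> and \<open>\<beta>\<close>. The work lies in showing that
  \<open>\<gamma>\<close> differs from both, as \<open>two_distance_set_bound\<close>
  demands.\<close>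

lemma multiplicity_bound:
  assumes "0 < i0" "i0 < r" and \<theta>: "l i0 = \<theta>" "0 < \<theta>"
  shows "valency G \<le> (card {i. i < r \<and> l i = \<theta>} + 1)\<^sup>2"
proof -
  define I where "I = {i. i < r \<and> l i = \<theta>}"
  define E where "E = (\<lambda>x y. \<Sum>i\<in>I. u i x * u i y)"
  define k where "k = real (valency G)"
  have E_dist: "E x' y' = E x y"
    if "x \<in> pverts G" "y \<in> pverts G" "x' \<in> pverts G" "y' \<in> pverts G"
      "graph_dist G x y \<le> 2" "graph_dist G x' y' = graph_dist G x y" for x y x' y'
    unfolding E_def I_def using that by (rule eigenspace_projection_dist)
  have E_sym: "E x y = E y x" for x y by (simp add: E_def mult.commute)
  have E_eig: "(\<Sum>z\<in>nbrs x. E z y) = \<theta> * E x y" if "x \<in> pverts G" for x y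
  proof -
    have "(\<Sum>z\<in>nbrs x. E z y) = (\<Sum>i\<in>I. \<Sum>z\<in>nbrs x. u i z * u i y)"
      unfolding E_def by (rule sum.swap)
    also have "\<dots> = (\<Sum>i\<in>I. \<theta> * (u i x * u i y))"
      unfolding sum_distrib_right[symmetric] using that by (intro sum.cong) (auto simp: I_def eigenvector_nbrs)
    finally show ?thesis by (simp add: E_def sum_distrib_left)
  qed
  obtain x0 y0 where arc0: "(x0, y0) \<in> parcs G" using ex_arc[OF two_walk_regular] by blast
  then have v0: "x0 \<in> pverts G" "y0 \<in> pverts G" by (auto dest: arc_verts)
  obtain x2 y2 where v2: "x2 \<in> pverts G" "y2 \<in> pverts G" and d2: "graph_dist G x2 y2 = 2"
    using ex_dist_2[OF two_walk_regular] by blast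
  define \<gamma> where "\<gamma> = E x0 x0"
  define \<alpha> where "\<alpha> = E x0 y0"
  define \<beta> where "\<beta> = E x2 y2"
  have E0: "E x x = \<gamma>" if "x \<in> pverts G" for x
    unfolding \<gamma>_def using that v0 by (intro E_dist) (auto simp: graph_dist_self)
  have E1: "E x y = \<alpha>" if "(x, y) \<in> parcs G" for x y
    unfolding \<alpha>_def using that arc0 arc_verts
    by (intro E_dist) (auto simp: graph_dist_arc[OF pair_graph_axioms])
  have E1': "E y x = \<alpha>" if "(x, y) \<in> parcs G" for x y
    using E1[OF that] E_sym[of x y] by simp
  have E2: "E x y = \<beta>" if "x \<in> pverts G" "y \<in> pverts G" "graph_dist G x y = 2" for x y
    unfolding \<beta>_def using that v2 d2 by (intro E_dist) auto
  have \<theta>k: "\<theta> \<noteq> k" using eigenvalue_ne_valency[OF assms(1,2)] \<theta> by (simp add: k_def)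
  have "\<gamma> \<noteq> 0"
  proof
    assume "\<gamma> = 0"
    have "u i0 x = 0" if "x \<in> pverts G" for x
    proof -
      have "(\<Sum>i\<in>I. (u i x)\<^sup>2) = 0" using E0[OF that] \<open>\<gamma> = 0\<close> by (simp add: E_def power2_eq_square)
      then show ?thesis using assms by (subst (asm) sum_nonneg_eq_0_iff) (auto simp: I_def)
    qed
    then have "adjm.dot (u i0) (u i0) = 0" by (simp add: adjm.dot_def)
    then show False using orthonormal assms by simp
  qed
  \<comment> \<open>The eigenvalue equation for \<open>E\<close> on the diagonal. Since
    \<open>\<gamma>\<close> is nonzero and \<open>\<theta>\<close> is not \<open>k\<close>, it
    separates \<open>\<alpha>\<close> from \<open>\<gamma>\<close>.\<close>
  have row: "k * \<alpha> = \<theta> * \<gamma>"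
  proof -
    have "(\<Sum>z\<in>nbrs x0. E z x0) = (\<Sum>z\<in>nbrs x0. \<alpha>)" by (intro sum.cong refl) (simp add: E1')
    then show ?thesis using E_eig[OF v0(1)] card_nbrs[OF v0(1)] by (simp add: k_def \<gamma>_def)
  qed
  have "\<gamma> \<noteq> \<alpha>" using row \<open>\<gamma> \<noteq> 0\<close> \<theta>k by auto
  \<comment> \<open>If \<open>\<gamma> = \<beta>\<close>, the eigenvalue equation along an arc leaves only \<open>\<theta> = k\<close> and
    \<open>\<theta> = a\<^sub>1 - k \<le> 0\<close>.\<close>
  moreover have "\<gamma> \<noteq> \<beta>"
  proof
    assume eq: "\<gamma> = \<beta>"
    \<comment> \<open>The neighbours of \<open>x0\<close> other than \<open>y0\<close> split into
      those adjacent to \<open>y0\<close>, forming \<open>C\<close>, and those at distance 2 from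
      it, forming \<open>R\<close>.\<close>
    define C where "C = nbrs x0 \<inter> nbrs y0"
    define R where "R = nbrs x0 - C - {y0}"
    have ny: "nbrs x0 = insert y0 (C \<union> R)" using arc0 by (auto simp: C_def R_def)
    have y0C: "y0 \<notin> C" using arc_irrefl by (simp add: C_def)
    have fin: "finite C" "finite (R)" using finite_nbrs by (auto simp: C_def R_def)
    have disj: "C \<inter> R = {}" "y0 \<notin> R" by (auto simp: R_def)
    have cC: "card C = a1 G" unfolding C_def by (rule card_common_adjacent[OF arc0])
    have "card (nbrs x0) = 1 + (card C + card (R))"
      by (subst ny) (use fin y0C disj in \<open>simp add: card_Un_disjoint\<close>)
    then have cR: "real (card (R)) = k - 1 - real (a1 G)"
      using card_nbrs[OF v0(1)] cC by (simp add: k_def)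
    have "(\<Sum>z\<in>nbrs x0. E z y0) = E y0 y0 + ((\<Sum>z\<in>C. E z y0) + (\<Sum>z\<in>R. E z y0))"
      by (subst ny) (use fin y0C disj in \<open>simp add: sum.union_disjoint\<close>)
    also have "(\<Sum>z\<in>C. E z y0) = (\<Sum>z\<in>C. \<alpha>)"
      by (intro sum.cong refl) (simp add: C_def E1')
    also have "(\<Sum>z\<in>R. E z y0) = (\<Sum>z\<in>R. \<beta>)"
    proof (intro sum.cong refl)
      fix z assume z: "z \<in> R"
      then have "graph_dist G z y0 = 2"
        using arc0 by (intro dist_eq_2[of z x0]) (auto simp: C_def R_def intro: arcs_symmetric)
      then show "E z y0 = \<beta>" using z v0 arc_verts by (intro E2) (auto simp: R_def)
    qed
    finally have "\<theta> * \<alpha> = \<gamma> + real (a1 G) * \<alpha> + (k - 1 - real (a1 G)) * \<gamma>"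
      using E_eig[OF v0(1), of y0] E0[OF v0(2)] cC cR eq by (simp add: \<alpha>_def)
    then have "k * (\<theta> * \<alpha>) = k * (\<gamma> + real (a1 G) * \<alpha> + (k - 1 - real (a1 G)) * \<gamma>)"
      by simp
    then have "\<theta> * (k * \<alpha>) = (k - real (a1 G)) * k * \<gamma> + real (a1 G) * (k * \<alpha>)"
      by (simp add: algebra_simps)
    then have "((k - \<theta>) * (\<theta> + k - real (a1 G))) * \<gamma> = 0"
      unfolding row by (simp add: algebra_simps)
    moreover have "0 < \<theta> + k - real (a1 G)"
    proof -
      have "card C \<le> card (nbrs x0)" using finite_nbrs by (intro card_mono) (auto simp: C_def)
      then show ?thesis using \<theta>(2) cC card_nbrs[OF v0(1)] by (simp add: k_def)
    qed
    ultimately show False using \<open>\<gamma> \<noteq> 0\<close> \<theta>k by simp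
  qed
  ultimately have "card (nbrs x0) \<le> (card I + 1)\<^sup>2"
  proof (intro two_distance_set_bound[of I "nbrs x0" \<gamma> \<alpha> \<beta> u])
    show "(\<Sum>i\<in>I. u i y * u i y) = \<gamma>" if "y \<in> nbrs x0" for y
      using E0 that arc_verts by (simp add: E_def)
    show "(\<Sum>i\<in>I. u i y * u i z) \<in> {\<alpha>, \<beta>}" if yz: "y \<in> nbrs x0" "z \<in> nbrs x0" "y \<noteq> z" for y z
    proof (cases "(y, z) \<in> parcs G")
      case True
      then show ?thesis using E1 by (simp add: E_def)
    next
      case False
      then have "graph_dist G y z = 2"
        using yz by (intro dist_eq_2[of y x0]) (auto intro: arcs_symmetric)
      then show ?thesis using E2 yz arc_verts by (simp add: E_def)
    qed
  qed (use finite_nbrs in \<open>auto simp: I_def\<close>)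
  then show ?thesis using card_nbrs[OF v0(1)] by (simp add: I_def)
qed

end

section \<open>Bounds on the valency and the order\<close>

lemma (in walk_regular_eigenbasis) smallest_eigenvalue_le_eigenvalue:
  assumes "i < r"
  shows "smallest_eigenvalue G \<le> l i"
proof -
  have "\<exists>x\<in>pverts G. u i x \<noteq> 0"
  proof (rule ccontr)
    assume "\<not> ?thesis"
    then have "adjm.dot (u i) (u i) = 0" by (simp add: adjm.dot_def)
    then show False using orthonormal[OF assms assms] by simp
  qed
  then obtain x where "x \<in> pverts G" "u i x \<noteq> 0" by blast
  then show ?thesis
    using eigenvector[OF assms]
    by (intro smallest_eigenvalue_le[OF pair_graph_axioms, of x "u i"]) (auto simp: adj_def)
qed

context two_walk_regular_graph
begin

text \<open>The normalized constant vector is an eigensystem by itself, and completing it keeps it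
  at index 0.\<close>

lemma ex_eigenbasis: "\<exists>r u l c. walk_regular_eigenbasis G r u l c"
proof -
  define n where "n = real (card (pverts G))"
  have n: "n > 0" using nonempty pair_finite_verts by (simp add: n_def card_gt_0_iff)
  define c where "c = 1 / sqrt n"
  have "adjm.eigensystem 1 (\<lambda>_ _. c) (\<lambda>_. real (valency G))"
  proof -
    have "(\<Sum>y\<in>pverts G. adj x y * c) = real (valency G) * c" if "x \<in> pverts G" for x
      unfolding sum_adj using card_nbrs[OF that] by simp
    moreover have "(\<Sum>y\<in>pverts G. c * c) = 1"
      using n by (simp add: c_def n_def[symmetric])
    ultimately show ?thesis
      by (simp add: adjm.eigensystem_def adjm.dot_def adjm.app_def)
  qed
  from adjm.eigensystem_complete[OF this] obtain r u l where *: "1 \<le> r" "adjm.eigensystem r u l"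
    "\<forall>i<1. u i = (\<lambda>_. c) \<and> l i = real (valency G)"
    "\<forall>x\<in>pverts G. \<forall>y\<in>pverts G. (\<Sum>i<r. u i x * u i y) = (if x = y then 1 else 0)"
    by auto
  have "walk_regular_eigenbasis G r u l c"
    using * n
    by (intro walk_regular_eigenbasis.intro two_walk_regular_graph_axioms eigenbasis.intro
        adjm.symmetric_matrix_axioms eigenbasis_axioms.intro walk_regular_eigenbasis_axioms.intro)
       (auto simp: c_def)
  then show ?thesis by blast
qed

text \<open>The test vector has entry \<open>-w\<close> at the centre and \<open>1\<close> at the leaves of the star formed by \<open>x\<close>
  and \<open>S\<close>.\<close>

lemma independent_neighbours_bound:
  assumes ray: "\<And>f. - w * adjm.dot f f \<le> adjm.dot f (adjm.app f)" and w: "0 < w"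
    and x: "x \<in> pverts G" and S: "S \<subseteq> nbrs x" "\<And>s t. s \<in> S \<Longrightarrow> t \<in> S \<Longrightarrow> (s, t) \<notin> parcs G"
  shows "real (card S) \<le> w\<^sup>2"
proof -
  have xS: "x \<notin> S" using S(1) arc_irrefl by auto
  have SV: "S \<subseteq> pverts G" using S(1) nbrs_subset by blast
  have arcs: "(x, s) \<in> parcs G" "(s, x) \<in> parcs G" if "s \<in> S" for s
  proof -
    show "(x, s) \<in> parcs G" using S(1) that by auto
    then show "(s, x) \<in> parcs G" by (rule arcs_symmetric)
  qed
  define f where "f = (\<lambda>z. if z = x then - w else if z \<in> S then 1 else (0::real))"
  have fdot: "adjm.dot f g = - w * g x + sum g S" for g
  proof -
    have "adjm.dot f g = (\<Sum>z\<in>pverts G. (if z = x then - w * g z else 0) + (if z \<in> S then g z else 0))"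
      unfolding adjm.dot_def by (intro sum.cong refl) (use xS in \<open>auto simp: f_def\<close>)
    also have "\<dots> = - w * g x + (\<Sum>z\<in>pverts G \<inter> S. g z)"
      using x pair_finite_verts by (simp add: sum.distrib sum.inter_restrict)
    also have "pverts G \<inter> S = S" using SV by blast
    finally show ?thesis .
  qed
  have app: "adjm.app f y = - w * adj y x + sum (adj y) S" for y
    unfolding fdot[symmetric] by (simp add: adjm.app_def adjm.dot_def mult.commute)
  have "adjm.app f x = real (card S)" unfolding app using arcs arc_irrefl by (simp add: adj_def)
  moreover have "(\<Sum>s\<in>S. adjm.app f s) = (\<Sum>s\<in>S. - w)"
    unfolding app using arcs S(2) by (intro sum.cong refl) (simp add: adj_def)
  ultimately have "adjm.dot f (adjm.app f) = - 2 * (w * real (card S))"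
    unfolding fdot by simp
  moreover have "(\<Sum>s\<in>S. f s) = (\<Sum>s\<in>S. 1)"
    using xS by (intro sum.cong refl) (auto simp: f_def)
  then have "adjm.dot f f = w * w + real (card S)"
    unfolding fdot by (simp add: f_def)
  ultimately have "w * real (card S) \<le> w * (w * w)"
    using ray[of f] by (simp add: algebra_simps)
  then show ?thesis using w by (simp add: power2_eq_square)
qed

text \<open>By maximality, every neighbour of \<open>x\<close> belongs to the independent set
  \<open>S\<close> or is adjacent to a member of it. The neighbourhood is thus covered by
  \<open>card S\<close> sets, each consisting of some \<open>s\<close> and its \<open>a1 G\<close>
  common neighbours with \<open>x\<close>.\<close>

lemma valency_le_local:
  assumes ray: "\<And>f. - w * adjm.dot f f \<le> adjm.dot f (adjm.app f)" and w: "0 < w"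
  shows "real (valency G) \<le> w\<^sup>2 * (real (a1 G) + 1)"
proof -
  obtain x where x: "x \<in> pverts G" using nonempty by blast
  define F where "F = {S. S \<subseteq> nbrs x \<and> (\<forall>s\<in>S. \<forall>t\<in>S. (s, t) \<notin> parcs G)}"
  have "finite F" by (rule finite_subset[of _ "Pow (nbrs x)"]) (use finite_nbrs in \<open>auto simp: F_def\<close>)
  moreover have "{} \<in> F" by (simp add: F_def)
  ultimately obtain S where S: "S \<in> F" "\<And>T. T \<in> F \<Longrightarrow> S \<subseteq> T \<Longrightarrow> S = T"
    using finite_has_maximal[of F] by blast
  have SF: "S \<subseteq> nbrs x" "\<And>s t. s \<in> S \<Longrightarrow> t \<in> S \<Longrightarrow> (s, t) \<notin> parcs G"
    using S(1) by (auto simp: F_def)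
  have finS: "finite S" using SF(1) finite_nbrs finite_subset by blast
  have "nbrs x \<subseteq> (\<Union>s\<in>S. insert s (nbrs x \<inter> nbrs s))"
  proof
    fix y assume y: "y \<in> nbrs x"
    show "y \<in> (\<Union>s\<in>S. insert s (nbrs x \<inter> nbrs s))"
    proof (rule ccontr)
      assume no: "\<not> ?thesis"
      have "y \<notin> S" using no by blast
      moreover have "(s, y) \<notin> parcs G" "(y, s) \<notin> parcs G" if "s \<in> S" for s
        using no that y by (auto intro: arcs_symmetric)
      then have "insert y S \<in> F" using SF y arc_irrefl by (auto simp: F_def)
      then have "S = insert y S" using S(2) by blast
      ultimately show False by blast
    qed
  qed
  then have "card (nbrs x) \<le> card (\<Union>s\<in>S. insert s (nbrs x \<inter> nbrs s))"
    using finS finite_nbrs by (intro card_mono) auto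
  also have "\<dots> \<le> (\<Sum>s\<in>S. card (insert s (nbrs x \<inter> nbrs s)))"
    by (rule card_UN_le[OF finS])
  also have "\<dots> = (\<Sum>s\<in>S. a1 G + 1)"
  proof (intro sum.cong refl)
    fix s assume "s \<in> S"
    then have "(x, s) \<in> parcs G" using SF(1) by auto
    then show "card (insert s (nbrs x \<inter> nbrs s)) = a1 G + 1"
      using card_common_adjacent finite_nbrs arc_irrefl by simp
  qed
  finally have "real (valency G) \<le> real (card S * (a1 G + 1))"
    unfolding card_nbrs[OF x] sum_constant of_nat_le_iff by simp
  also have "\<dots> = real (card S) * (real (a1 G) + 1)" by (simp add: algebra_simps)
  also have "\<dots> \<le> w\<^sup>2 * (real (a1 G) + 1)"
    using independent_neighbours_bound[OF ray w x SF] by (intro mult_right_mono) auto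
  finally show ?thesis .
qed

section \<open>Distance layers and the order of the graph\<close>

definition layer :: "'a \<Rightarrow> nat \<Rightarrow> 'a set" where
  "layer x i = {z \<in> pverts G. graph_dist G x z = i}"

lemma finite_layer: "finite (layer x i)"
  using pair_finite_verts by (simp add: layer_def)

text \<open>Double counting of the arcs between consecutive layers. A vertex \<open>z\<close> of the
  outer layer is at distance 2 from some \<open>v\<close> in layer \<open>i - 1\<close>, which
  exists because \<open>i\<close> is positive, and all their common neighbours lie in layer
  \<open>i\<close>.\<close>

lemma layer_step:
  assumes x: "x \<in> pverts G" and i: "0 < i"
  shows "card (layer x (Suc i)) * c2 G \<le> card (layer x i) * valency G"
proof -
  have lower: "c2 G \<le> card {y \<in> layer x i. (y, z) \<in> parcs G}" if z: "z \<in> layer x (Suc i)" for z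
  proof -
    have zV: "z \<in> pverts G" "graph_dist G x z = Suc i" using z by (auto simp: layer_def)
    obtain t where t: "(t, z) \<in> parcs G" "graph_dist G x t = i"
      using dist_pred[OF x zV] by blast
    obtain j where j: "i = Suc j" using i gr0_implies_Suc by blast
    obtain v where v: "(v, t) \<in> parcs G" "graph_dist G x v = j"
      using dist_pred[OF x arc_verts(1)[OF t(1)], of j] t(2) j by auto
    have "(v, z) \<notin> parcs G" using dist_step[OF x, of v z] zV(2) v(2) j by auto
    moreover have "v \<noteq> z" using zV(2) v(2) j by auto
    ultimately have "graph_dist G v z = 2" using dist_eq_2[OF v(1) t(1)] by blast
    then have "c2 G = card (nbrs v \<inter> nbrs z)"
      using card_common_dist_2 arc_verts(1)[OF v(1)] zV(1) by simp
    also have "\<dots> \<le> card {y \<in> layer x i. (y, z) \<in> parcs G}"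
    proof (intro card_mono subsetI)
      fix y assume "y \<in> nbrs v \<inter> nbrs z"
      then have y: "(v, y) \<in> parcs G" "(y, z) \<in> parcs G" by (auto intro: arcs_symmetric)
      \<comment> \<open>The step from \<open>v\<close> to \<open>y\<close> bounds the distance from
        above, the step from \<open>y\<close> to \<open>z\<close> from below.\<close>
      have "graph_dist G x y = i"
        using dist_step[OF x y(1)] dist_step[OF x y(2)] v(2) zV(2) j by simp
      then show "y \<in> {y \<in> layer x i. (y, z) \<in> parcs G}"
        using y arc_verts(2)[OF y(1)] by (simp add: layer_def)
    qed (simp add: finite_layer)
    finally show ?thesis .
  qed
  have upper: "card {z \<in> layer x (Suc i). (y, z) \<in> parcs G} \<le> valency G" if "y \<in> layer x i" for y
  proof -
    have "card {z \<in> layer x (Suc i). (y, z) \<in> parcs G} \<le> card (nbrs y)"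
      by (intro card_mono) (auto simp: finite_nbrs)
    then show ?thesis using card_nbrs that by (simp add: layer_def)
  qed
  have "card (layer x (Suc i)) * c2 G = (\<Sum>z\<in>layer x (Suc i). c2 G)" by simp
  also have "\<dots> \<le> (\<Sum>z\<in>layer x (Suc i). card {y \<in> layer x i. (y, z) \<in> parcs G})"
    by (intro sum_mono lower)
  also have "\<dots> = (\<Sum>y\<in>layer x i. card {z \<in> layer x (Suc i). (y, z) \<in> parcs G})"
    by (rule sum_multicount_gen[symmetric]) (auto simp: finite_layer)
  also have "\<dots> \<le> (\<Sum>y\<in>layer x i. valency G)" by (intro sum_mono upper)
  finally show ?thesis by simp
qed

lemma c2_pos: "0 < c2 G"
proof -
  obtain x y where xy: "x \<in> pverts G" "y \<in> pverts G" "graph_dist G x y = 2"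
    using ex_dist_2[OF two_walk_regular] by blast
  obtain t where t: "(t, y) \<in> parcs G" "graph_dist G x t = 1"
    using dist_pred[OF xy(1,2), of 1] xy(3) by auto
  have "(x, t) \<in> parcs G" using dist_eq_1[OF xy(1) arc_verts(1)[OF t(1)] t(2)] .
  then have "t \<in> nbrs x \<inter> nbrs y" using t(1) by (auto intro: arcs_symmetric)
  then have "0 < card (nbrs x \<inter> nbrs y)" using finite_nbrs by (auto simp: card_gt_0_iff)
  then show ?thesis using card_common_dist_2[OF xy] by simp
qed

lemma valency_pos: "0 < valency G"
proof -
  obtain x y where "(x, y) \<in> parcs G" using ex_arc[OF two_walk_regular] by blast
  then have "0 < card (nbrs x)" using finite_nbrs by (auto simp: card_gt_0_iff)
  then show ?thesis using card_nbrs arc_verts \<open>(x, y) \<in> parcs G\<close> by metis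
qed

text \<open>\<open>R\<close> bounds the ratio of \<open>valency G\<close> to \<open>c2 G\<close>,
  which by \<open>layer_step\<close> is the growth factor from one layer to the next.\<close>

lemma card_layer_le:
  assumes x: "x \<in> pverts G" and R: "real (valency G) \<le> R * real (c2 G)" "0 \<le> R"
  shows "real (card (layer x (Suc i))) \<le> real (valency G) * R ^ i"
proof (induction i)
  case 0
  have "layer x (Suc 0) = nbrs x"
    using x dist_eq_1[OF x] graph_dist_arc[OF pair_graph_axioms, of x] arc_verts
    by (auto simp: layer_def)
  then show ?case using card_nbrs[OF x] by simp
next
  case (Suc i)
  have "real (card (layer x (Suc (Suc i)))) * real (c2 G) \<le> real (card (layer x (Suc i))) * real (valency G)"
    using layer_step[OF x, of "Suc i"] unfolding of_nat_mult[symmetric] of_nat_le_iff by simp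
  also have "\<dots> \<le> (real (valency G) * R ^ i) * (R * real (c2 G))"
    using Suc R by (intro mult_mono) auto
  also have "\<dots> = (real (valency G) * R ^ Suc i) * real (c2 G)" by (simp add: mult_ac)
  finally show ?case using c2_pos by simp
qed

lemma card_verts_le:
  assumes R: "real (valency G) \<le> R * real (c2 G)" "2 \<le> R" and D: "diameter G = D" "2 \<le> D"
  shows "real (card (pverts G)) \<le> real (valency G) * real D * R ^ (D - 1)"
proof -
  obtain x where x: "x \<in> pverts G" using nonempty by blast
  obtain m where m: "D = Suc m" "0 < m" using D(2) by (cases D) auto
  define k where "k = real (valency G)"
  have k: "1 \<le> k" using valency_pos by (simp add: k_def)
  have "layer x 0 = {x}" using x dist_eq_0[OF x] graph_dist_self by (auto simp: layer_def)
  moreover have "pverts G = (\<Union>i\<le>D. layer x i)"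
    using dist_le_diameter[OF x] D(1) by (auto simp: layer_def)
  then have "card (pverts G) \<le> (\<Sum>i\<le>D. card (layer x i))"
    using card_UN_le[of "{..D}" "layer x"] by simp
  then have "card (pverts G) \<le> card (layer x 0) + (\<Sum>i\<le>m. card (layer x (Suc i)))"
    unfolding m(1) by (simp only: sum.atMost_Suc_shift)
  ultimately have "card (pverts G) \<le> 1 + (\<Sum>i\<le>m. card (layer x (Suc i)))" by simp
  then have "real (card (pverts G)) \<le> real (1 + (\<Sum>i\<le>m. card (layer x (Suc i))))"
    unfolding of_nat_le_iff .
  also have "\<dots> = 1 + (\<Sum>i\<le>m. real (card (layer x (Suc i))))" by simp
  also have "\<dots> \<le> 1 + (\<Sum>i\<le>m. k * R ^ i)"
    unfolding k_def using card_layer_le[OF x R(1)] R(2) by (intro add_left_mono sum_mono) auto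
  also have "\<dots> = 1 + k + (\<Sum>i<m. k * R ^ Suc i)"
    by (simp only: lessThan_Suc_atMost[symmetric] sum.lessThan_Suc_shift) simp
  \<comment> \<open>The contribution \<open>1 + k\<close> of layers 0 and 1 is at most
    \<open>2 * k\<close>, hence at most \<open>k * R ^ m\<close>. With the \<open>m\<close> further
    layers this makes \<open>D\<close> summands of that size.\<close>
  also have "\<dots> \<le> k * R ^ m + (\<Sum>i<m. k * R ^ m)"
  proof (intro add_mono sum_mono)
    have "R ^ 1 \<le> R ^ m" using R(2) m(2) by (intro power_increasing) auto
    then have "k * 2 \<le> k * R ^ m" using R(2) k by (intro mult_left_mono) auto
    then show "1 + k \<le> k * R ^ m" using k by linarith
    show "k * R ^ Suc i \<le> k * R ^ m" if "i \<in> {..<m}" for i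
      using that R(2) k by (intro mult_left_mono power_increasing) auto
  qed
  also have "\<dots> = k * real D * R ^ (D - 1)" using m by (simp add: algebra_simps)
  finally show ?thesis by (simp add: k_def)
qed

text \<open>Two vertices at distance at least 3 have disjoint closed neighbourhoods.\<close>

lemma card_verts_ge:
  assumes "3 \<le> diameter G"
  shows "2 * valency G + 2 \<le> card (pverts G)"
proof -
  obtain x y where xy: "x \<in> pverts G" "y \<in> pverts G" "3 \<le> graph_dist G x y"
    using diameter_attained assms by metis
  have 1: "z \<notin> nbrs y" if "z \<in> nbrs x" for z
  proof
    assume "z \<in> nbrs y"
    then have "(z, y) \<in> parcs G" by (auto intro: arcs_symmetric)
    then have "graph_dist G x y \<le> 2"
      using dist_step[OF xy(1), of z y] graph_dist_arc[OF pair_graph_axioms, of x z] that by simp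
    then show False using xy(3) by simp
  qed
  have 2: "(x, y) \<notin> parcs G" "(y, x) \<notin> parcs G"
    using graph_dist_arc[OF pair_graph_axioms, of x y] xy(3) by (auto dest: arcs_symmetric)
  have "x \<noteq> y" using graph_dist_self xy by fastforce
  then have "insert x (nbrs x) \<inter> insert y (nbrs y) = {}" using 1 2 by auto
  then have "card (insert x (nbrs x) \<union> insert y (nbrs y)) = card (insert x (nbrs x)) + card (insert y (nbrs y))"
    using finite_nbrs by (intro card_Un_disjoint) auto
  also have "\<dots> = 2 * valency G + 2" using finite_nbrs arc_irrefl card_nbrs xy by simp
  finally have "2 * valency G + 2 = card (insert x (nbrs x) \<union> insert y (nbrs y))" ..
  also have "\<dots> \<le> card (pverts G)" using nbrs_subset xy pair_finite_verts by (intro card_mono) auto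
  finally show ?thesis .
qed

end

section \<open>Combination of the estimates into the bound on the valency\<close>

text \<open>Here \<open>M\<close> stands for the multiplicity of \<open>\<theta>\<close> and
  \<open>n\<close> for the order. As \<open>n\<close> is at most linear in \<open>k\<close> and
  \<open>\<theta>\<close> at least linear, the powers of \<open>k\<close> cancel in
  \<open>mult\<close>, which bounds \<open>M\<close> in terms of \<open>D\<close> and
  \<open>R\<close> alone; \<open>kM\<close> then bounds \<open>k\<close>.\<close>

lemma valency_estimate:
  fixes k w R \<theta> n M :: real and D :: nat
  assumes w: "2 \<le> w" and R: "2 * w\<^sup>2 \<le> R" and k: "2 * w \<le> k" and D: "1 \<le> D" and M: "1 \<le> M"
    and kM: "k \<le> (M + 1)\<^sup>2" and mult: "M * \<theta>\<^sup>2 \<le> n * k" and \<theta>: "k - w \<le> 2 * w * \<theta>"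
    and n: "n \<le> k * real D * R ^ (D - 1)"
  shows "k < real D ^ 2 * R ^ (2 * D + 4)"
proof -
  have "4 \<le> w\<^sup>2" using power_mono[OF w, of 2] by simp
  then have R8: "8 \<le> R" using R by linarith
  have kpos: "0 < k" using k w by linarith
  \<comment> \<open>From \<open>2 * w \<le> k\<close> it follows that
    \<open>k \<le> 2 * (k - w)\<close>.\<close>
  have "k \<le> 4 * w * \<theta>" using \<theta> k by linarith
  then have "k\<^sup>2 \<le> (4 * w * \<theta>)\<^sup>2" using kpos by (intro power_mono) auto
  then have "M * k\<^sup>2 \<le> M * (4 * w * \<theta>)\<^sup>2" using M by (intro mult_left_mono) auto
  also have "\<dots> = 16 * w\<^sup>2 * (M * \<theta>\<^sup>2)" by (simp add: power_mult_distrib)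
  also have "\<dots> \<le> 16 * w\<^sup>2 * (n * k)" using mult by (intro mult_left_mono) auto
  also have "\<dots> \<le> 8 * R * (n * k)"
  proof (rule mult_right_mono)
    show "16 * w\<^sup>2 \<le> 8 * R" using R by simp
    have "0 \<le> M * \<theta>\<^sup>2" using M by simp
    then show "0 \<le> n * k" using mult by linarith
  qed
  also have "\<dots> \<le> 8 * R * (k * real D * R ^ (D - 1) * k)"
    using n R8 kpos by (intro mult_left_mono mult_right_mono) auto
  also have "\<dots> = 8 * real D * R ^ D * k\<^sup>2"
    using D by (cases D) (simp_all add: power2_eq_square mult_ac)
  finally have M2: "M \<le> 8 * real D * R ^ D" using kpos by simp
  \<comment> \<open>Since \<open>1 \<le> M\<close>, \<open>M + 1\<close> is at most twice
    \<open>M\<close>.\<close>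
  have "(M + 1)\<^sup>2 \<le> (2 * (8 * real D * R ^ D))\<^sup>2" using M M2 by (intro power_mono) auto
  also have "\<dots> = 256 * (real D ^ 2 * R ^ (2 * D))" by (simp add: power_mult_distrib power_mult[symmetric] mult.commute)
  also have "\<dots> < R ^ 4 * (real D ^ 2 * R ^ (2 * D))"
  proof (rule mult_strict_right_mono)
    \<comment> \<open>The summand 4 in the exponent of the final bound absorbs the constant 256,
      because \<open>8 \<le> R\<close>.\<close>
    show "256 < R ^ 4" using power_mono[OF R8, of 4] by simp
    show "0 < real D ^ 2 * R ^ (2 * D)" using D R8 by simp
  qed
  finally show ?thesis using kM by (simp add: power_add mult_ac)
qed

context two_walk_regular_graph
begin

text \<open>The second conclusion, on the order, is what finiteness up to isomorphism rests
  on.\<close>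

lemma valency_and_order_bound:
  fixes \<epsilon> :: real and \<omega> D :: nat
  assumes \<epsilon>: "0 < \<epsilon>" "\<epsilon> < 1" and \<omega>: "2 \<le> \<omega>" and D: "3 \<le> D" "diameter G = D"
    and ev: "smallest_eigenvalue G \<ge> - real \<omega>" and c2: "real (c2 G) \<ge> real (a1 G) * \<epsilon>"
  defines "R \<equiv> 2 * real \<omega> ^ 2 / \<epsilon>"
  shows "real (valency G) < real D ^ 2 * R ^ (2 * D + 4)"
    and "real (card (pverts G)) \<le> real (valency G) * real D * R ^ (D - 1)"
proof -
  obtain r u l c where "walk_regular_eigenbasis G r u l c" using ex_eigenbasis by blast
  then interpret B: walk_regular_eigenbasis G r u l c .
  define w where "w = real \<omega>"
  define k where "k = real (valency G)"
  have w: "2 \<le> w" using \<omega> by (simp add: w_def)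
  have R: "2 * w\<^sup>2 \<le> R"
    unfolding R_def w_def[symmetric] using \<epsilon> w by (simp add: field_simps mult_left_le)
  have ww: "2 * w \<le> w\<^sup>2" using w by (simp add: power2_eq_square)
  have R8: "8 \<le> R" using R ww w by linarith
  have l: "- w \<le> l i" if "i < r" for i
    using B.smallest_eigenvalue_le_eigenvalue[OF that] ev by (simp add: w_def)
  have loc: "k \<le> w\<^sup>2 * (real (a1 G) + 1)"
    unfolding k_def using B.rayleigh_bound[of w] l w by (intro valency_le_local) auto
  have ratio: "k \<le> R * real (c2 G)"
  \<comment> \<open>For positive \<open>a1 G\<close>, the estimate of \<open>a1 G + 1\<close> by
    \<open>2 * a1 G\<close> accounts for the factor 2 in \<open>R\<close>. If \<open>a1 G\<close> is
    0, the valency is at most the square of \<open>w\<close>, and \<open>c2 G \<ge> 1\<close>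
    suffices.\<close>
  proof (cases "a1 G = 0")
    case True
    then have "k \<le> w\<^sup>2" using loc by simp
    also have "\<dots> \<le> R * 1" using R zero_le_power2[of w] by linarith
    also have "\<dots> \<le> R * real (c2 G)" using c2_pos R8 by (intro mult_left_mono) auto
    finally show ?thesis .
  next
    case False
    then have "w\<^sup>2 * (real (a1 G) + 1) \<le> w\<^sup>2 * (2 * real (a1 G))" by (intro mult_left_mono) auto
    also have "\<dots> = R * (real (a1 G) * \<epsilon>)" using \<epsilon> by (simp add: R_def w_def)
    also have "\<dots> \<le> R * real (c2 G)" using c2 R8 by (intro mult_left_mono) auto
    finally show ?thesis using loc by simp
  qed
  show order: "real (card (pverts G)) \<le> real (valency G) * real D * R ^ (D - 1)"
    using ratio R8 D by (intro card_verts_le) (auto simp: k_def)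
  show "real (valency G) < real D ^ 2 * R ^ (2 * D + 4)"
  \<comment> \<open>The estimate through a large eigenvalue works for \<open>k \<ge> 2 * w\<close>;
    smaller valencies are already below \<open>R\<close>.\<close>
  proof (cases "2 * w \<le> k")
    case True
    have n2: "2 * valency G + 2 \<le> card (pverts G)" using card_verts_ge D by simp
    have "w \<le> real (valency G)" using True w by (simp add: k_def)
    then obtain i where i: "0 < i" "i < r" "k - w \<le> 2 * w * l i"
      using B.large_eigenvalue[OF n2 l] w unfolding k_def by (metis le_numeral_extra(4) one_le_numeral order_trans)
    have "0 < 2 * w * l i" using i(3) True w by linarith
    then have "0 < l i" using w by (simp add: zero_less_mult_iff)
    define M where "M = card {j. j < r \<and> l j = l i}"
    have "0 < M" using i(2) by (auto simp: M_def card_gt_0_iff)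
    have "valency G \<le> (M + 1)\<^sup>2"
      unfolding M_def by (rule B.multiplicity_bound[OF i(1,2) refl \<open>0 < l i\<close>])
    then have "real (valency G) \<le> real ((M + 1)\<^sup>2)" unfolding of_nat_le_iff .
    then have kM: "k \<le> (real M + 1)\<^sup>2" by (simp add: k_def add.commute)
    have mult: "real M * (l i)\<^sup>2 \<le> real (card (pverts G)) * k"
      unfolding M_def k_def by (rule B.card_eigenspace_le)
    show ?thesis unfolding k_def[symmetric]
      using valency_estimate[OF w R True _ _ kM mult i(3)] order D \<open>0 < M\<close> by (simp add: k_def)
  next
    case False
    have "k < 2 * w" using False by simp
    also have "\<dots> \<le> R" using R ww w by linarith
    also have "\<dots> = 1 * R ^ 1" by simp
    also have "\<dots> \<le> real D ^ 2 * R ^ (2 * D + 4)"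
      using R8 D by (intro mult_mono power_increasing one_le_power) auto
    finally show ?thesis by (simp add: k_def)
  qed
qed

end

section \<open>Finiteness up to isomorphism\<close>

lemma two_walk_regular_pair_graph: "two_walk_regular G \<Longrightarrow> pair_graph G"
  unfolding two_walk_regular_def by (rule conjunct1)

text \<open>Transport to an initial segment of the naturals gives all graphs of bounded order
  representatives in one finite set.\<close>

lemma pair_digraph_relabel:
  fixes G :: "'a pair_pre_digraph"
  assumes "pair_graph G"
  obtains H :: "nat pair_pre_digraph" where "pverts H = {..<card (pverts G)}"
    "parcs H \<subseteq> pverts H \<times> pverts H" "digraph_iso (with_proj G) (with_proj H)"
proof -
  interpret pair_graph G by fact
  obtain f where f: "bij_betw f (pverts G) {..<card (pverts G)}"
    using ex_bij_betw_finite_nat[OF pair_finite_verts] by (auto simp: atLeast0LessThan)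
  define H where "H = \<lparr>pverts = f ` pverts G, parcs = map_prod f f ` parcs G\<rparr>"
  define h where "h = \<lparr>iso_verts = f, iso_arcs = map_prod f f, iso_head = snd, iso_tail = fst\<rparr>"
  have inj: "inj_on f (pverts G)" using f by (rule bij_betw_imp_inj_on)
  have sub: "parcs G \<subseteq> pverts G \<times> pverts G" by (auto dest: in_arcsD1 in_arcsD2)
  have "inj_on (map_prod f f) (parcs G)"
    using map_prod_inj_on[OF inj inj] sub by (rule inj_on_subset)
  then have "digraph_isomorphism h"
    using inj wf_digraph by (auto simp: digraph_isomorphism_def h_def)
  moreover have "with_proj H = app_iso h (with_proj G)"
    by (simp add: H_def h_def app_iso_def with_proj_def)
  ultimately have "digraph_iso (with_proj G) (with_proj H)"
    unfolding digraph_iso_def by blast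
  then show ?thesis
    using that[of H] sub bij_betw_imp_surj_on[OF f] by (auto simp: H_def)
qed

text \<open>Such a digraph is determined by its vertex set and its arc set, each ranging over a
  finite power set.\<close>

lemma finite_pair_digraphs:
  "finite {H :: nat pair_pre_digraph. pverts H \<subseteq> {..N} \<and> parcs H \<subseteq> {..N} \<times> {..N}}"
proof (rule finite_subset)
  show "{H :: nat pair_pre_digraph. pverts H \<subseteq> {..N} \<and> parcs H \<subseteq> {..N} \<times> {..N}} \<subseteq>
      (\<lambda>(V, E). \<lparr>pverts = V, parcs = E\<rparr>) ` (Pow {..N} \<times> Pow ({..N} \<times> {..N}))"
  proof
    fix H :: "nat pair_pre_digraph"
    assume "H \<in> {H. pverts H \<subseteq> {..N} \<and> parcs H \<subseteq> {..N} \<times> {..N}}"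
    then show "H \<in> (\<lambda>(V, E). \<lparr>pverts = V, parcs = E\<rparr>) ` (Pow {..N} \<times> Pow ({..N} \<times> {..N}))"
      by (intro image_eqI[of _ _ "(pverts H, parcs H)"]) auto
  qed
qed auto

theorem theorem7p5:
  fixes \<epsilon> :: real and \<omega> D :: nat
  assumes "0 < \<epsilon>" and "\<epsilon> < 1" and "2 \<le> \<omega>" and "3 \<le> D"
  shows "(\<forall>\<Gamma> :: 'a pair_pre_digraph.
            two_walk_regular \<Gamma> \<and> diameter \<Gamma> = D \<and> smallest_eigenvalue \<Gamma> \<ge> - real \<omega> \<and>
            real (c2 \<Gamma>) \<ge> real (a1 \<Gamma>) * \<epsilon> \<longrightarrow>
            real (valency \<Gamma>) < real D ^ 2 * (2 * real \<omega> ^ 2 / \<epsilon>) ^ (2 * D + 4)) \<and>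
         (\<exists>F :: nat pair_pre_digraph set. finite F \<and>
            (\<forall>\<Gamma> :: 'a pair_pre_digraph.
               two_walk_regular \<Gamma> \<and> diameter \<Gamma> = D \<and> smallest_eigenvalue \<Gamma> \<ge> - real \<omega> \<and>
               real (c2 \<Gamma>) \<ge> real (a1 \<Gamma>) * \<epsilon> \<longrightarrow>
               (\<exists>H\<in>F. digraph_iso (with_proj \<Gamma>) (with_proj H))))"
proof -
  define R where "R = 2 * real \<omega> ^ 2 / \<epsilon>"
  \<comment> \<open>Inserting the bound on the valency into the bound on the order leaves a quantity
    depending only on \<open>D\<close>, \<open>\<omega>\<close> and \<open>\<epsilon>\<close>;
    \<open>N\<close> is an integer not below it.\<close>
  obtain N :: nat where N: "real D ^ 2 * R ^ (2 * D + 4) * real D * R ^ (D - 1) \<le> real N"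
    using real_arch_simple by blast
  have R: "0 \<le> R" unfolding R_def using assms(1) by (intro divide_nonneg_pos mult_nonneg_nonneg) simp_all
  have bounds: "real (valency \<Gamma>) < real D ^ 2 * R ^ (2 * D + 4) \<and> card (pverts \<Gamma>) \<le> N"
    if "two_walk_regular \<Gamma> \<and> diameter \<Gamma> = D \<and> smallest_eigenvalue \<Gamma> \<ge> - real \<omega> \<and>
      real (c2 \<Gamma>) \<ge> real (a1 \<Gamma>) * \<epsilon>" for \<Gamma> :: "'a pair_pre_digraph"
  proof -
    have "two_walk_regular \<Gamma>" using that by blast
    then interpret two_walk_regular_graph \<Gamma>
      by (intro two_walk_regular_graph.intro two_walk_regular_graph_axioms.intro two_walk_regular_pair_graph)
    have *: "real (valency \<Gamma>) < real D ^ 2 * R ^ (2 * D + 4)"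
      "real (card (pverts \<Gamma>)) \<le> real (valency \<Gamma>) * real D * R ^ (D - 1)"
      unfolding R_def using valency_and_order_bound[of \<epsilon> \<omega> D] assms that by blast+
    have "real (valency \<Gamma>) * real D * R ^ (D - 1) \<le> real D ^ 2 * R ^ (2 * D + 4) * real D * R ^ (D - 1)"
      using *(1) R by (intro mult_right_mono) auto
    then have "real (card (pverts \<Gamma>)) \<le> real N" using *(2) using N by linarith
    then show ?thesis using *(1) by simp
  qed
  have "\<exists>H\<in>{H :: nat pair_pre_digraph. pverts H \<subseteq> {..N} \<and> parcs H \<subseteq> {..N} \<times> {..N}}.
      digraph_iso (with_proj \<Gamma>) (with_proj H)"
    if "two_walk_regular \<Gamma>" "card (pverts \<Gamma>) \<le> N" for \<Gamma> :: "'a pair_pre_digraph"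
  proof -
    have "pair_graph \<Gamma>" using that(1) by (rule two_walk_regular_pair_graph)
    then obtain H :: "nat pair_pre_digraph" where H: "pverts H = {..<card (pverts \<Gamma>)}"
      "parcs H \<subseteq> pverts H \<times> pverts H" "digraph_iso (with_proj \<Gamma>) (with_proj H)"
      by (rule pair_digraph_relabel)
    have "pverts H \<subseteq> {..N}" unfolding H(1) using that(2) by auto
    then show ?thesis using H(2,3) by blast
  qed
  then show ?thesis using bounds finite_pair_digraphs[of N] unfolding R_def by blast
qed

end
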